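(* Let $\psi_-\in X$ and, for $\varepsilon\in\,]0,1]$, let $r^\varepsilon\in X$. Suppose that Assumptions 1, 2 and 3 (stated in the context) are satisfied, and consider the Cauchy problem $$(\ast)\qquad L(\varepsilon\partial)u^\varepsilon(t,x)=\varepsilon^{\alpha(p-1)}F\left(\frac{x}{\varepsilon},u^\varepsilon(t,x)\right),\qquad u^\varepsilon(0,x)=A_-(\psi_-)\left(\frac{-1}{\varepsilon},\frac{x}{\varepsilon}\right)+r^\varepsilon(x).$$ If $r^\varepsilon$ is asymptotically small, $\|r^\varepsilon\|_{X,\varepsilon}\to 0$ as $\varepsilon\to 0$, then the following holds. (1) There exists $\varepsilon_0>0$ such that for all $0<\varepsilon<\varepsilon_0$ there exists a unique solution $u^\varepsilon\in C(\mathbb{R}_+,X)$ to $(\ast)$. (2) For every $0<\tau<1$, $$\sup_{t\in[0,\tau]}\left\|u^\varepsilon(t,\cdot)-\frac{1}{(1-t)^\alpha}A_-(\psi_-)\left(\frac{t-1}{\varepsilon},\frac{\cdot}{\varepsilon}\right)\right\|_{X,\varepsilon}\to 0\quad\text{as }\varepsilon\to0.$$ (3) For every $\tau>1$, $$\sup_{t\ge\tau}\left\|u^\varepsilon(t,\cdot)-\frac{1}{(t-1)^\alpha}A_+(\psi_+)\left(\frac{t-1}{\varepsilon},\frac{\cdot}{\varepsilon}\right)\right\|_{X,\varepsilon}\to 0\quad\text{as }\varepsilon\to0,$$ where $\psi_+=S\psi_-$. (4) There exists a "caustic profile": let $\varphi=W_-\psi_-\in X$. Then $$\left\|u^\varepsilon(1,\cdot)-\frac{1}{\varepsilon^\alpha}\varphi\left(\frac{\cdot}{\varepsilon}\right)\right\|_{X,\varepsilon}\to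 0\quad\text{as }\varepsilon\to0.$$
   Context: Setting. $L(\partial)=\partial_t+p(\partial_{x_1},\dots,\partial_{x_n})$ is a constant-coefficient differential operator acting on functions $\psi:\mathbb{R}\times\mathbb{R}^n\to\mathbb{C}^q$, where $p(\cdot)$ is a polynomial with coefficients in $\mathcal{M}_q(\mathbb{C})$; $L(\varepsilon\partial)=\varepsilon\partial_t+p(\varepsilon\partial_{x_1},\dots,\varepsilon\partial_{x_n})$. $X$ is a Banach space (of functions of $x\in\mathbb{R}^n$ with values in $\mathbb{C}^q$) invariant with respect to dilations: if $\varphi\in X$ then $\varphi(\lambda\,\cdot)\in X$ for all $\lambda>0$. The nonlinearity $F(x,z)$ is $p$-homogeneous in its last variable for some $p>1$ (the exponent $p$ is unrelated to the polynomial $p(\cdot)$): $F(x,\lambda z)=\lambda^pF(x,z)$ for all $(x,\lambda,z)\in\mathbb{R}^n\times\mathbb{R}_+^*\times\mathbb{C}^q$. Assumption 1. (a) The problem $L(\partial)\psi=0$, $\psi|_{t=0}=\varphi\in X$, has a unique solution $\psi\in C(\mathbb{R};X)$, and there exists a group $U_0$, unitary on $X$, such that $\psi(t)=U_0(t)\varphi$ for all $t\in\mathbb{R}$. (b) There exists $\alpha\ge0$ such that for every $\varphi\in\mathcal{S}(\mathbb{R}^n;\mathbb{C}^q)$ there exist $c_\pm=c_\pm(\varphi)<\infty$ with $\limsup_{t\to\pm\infty}|t|^\alpha\|U_0(t)\varphi(\cdot)\|_{L^\infty(\mathbb{R}^n,\mathbb{C}^q)}=c_\pm$, and there exist $\varphi_\pm$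 such that $c_\pm$ are nonzero. (c) There exist mappings $A_\pm:X\to C(\mathbb{R};X)$, written $A_\pm(\varphi)(t,x)$, such that for every $\varphi\in X$, $\left\|\varphi-U_0(-t)\left(|t|^{-\alpha}A_\pm(\varphi)(t,\cdot)\right)\right\|_X\to0$ as $t\to\pm\infty$. For a function $\psi(t)$ write $\widetilde\psi(t):=U_0(-t)\psi(t)$. Assumption 2. For every $\psi_-\in X$ there exists $T<\infty$ such that: (a) for every $t_0\in[-\infty,-T]$ the problem $L(\partial)\psi=F(x,\psi)$, $U_0(-t)\psi(t)|_{t=t_0}=\psi_-$, has a unique solution in $C(]-\infty,-T];X)$; (b) the solution $\psi\in C(]-\infty,-T];X)$ depends continuously on $\psi_-\in X$ and $t_0\in[-\infty,-T]$; (c) $\widetilde\psi\in C([-\infty,-T];X)$; in particular, if $t_0=-\infty$, $\lim_{t\to-\infty}\widetilde\psi(t)=\psi_-$. Assumption 3. (a) The problem $L(\partial)\psi=F(x,\psi)$, $\psi|_{t=0}=\varphi$, is globally well-posed in $C(\mathbb{R};X)$: for every $R>0$ and every $\varphi\in B_R:=\{\varphi\in X:\|\varphi\|_X<R\}$ it has a unique solution $\psi\in C(\mathbb{R};X)$; moreover, the map $\varphi\mapsto\widetilde\psi$ is uniformly continuous from $B_R$ to $C(\mathbb{R};X)$. (b) For $\varphi\in X$ and $\psi$ the corresponding solution, there exist $\psi_\pm\in X$ such that $\|\widetilde\psi(t)-\psi_\pm\|_X=\|U_0(-t)\psi(t)-\psi_\pm\|_X\to0$ as $t\to\pm\infty$.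 When Assumptions 2 and 3 are satisfied, the wave operators at $\pm\infty$ are $W_\pm:\psi_\pm\mapsto\psi|_{t=0}$ and the scattering operator is $S:\psi_-\mapsto\psi_+$. For $\varphi\in X$, $\varepsilon\in\,]0,1]$: $\|\varphi\|_{X,\varepsilon}:=\|\varepsilon^\alpha\varphi(\varepsilon\,\cdot)\|_X$. Meaning of $(\ast)$: $u^\varepsilon$ solves $(\ast)$ iff $\psi^\varepsilon$, defined by $u^\varepsilon(t,x)=\varepsilon^{-\alpha}\psi^\varepsilon\left(\frac{t-1}{\varepsilon},\frac{x}{\varepsilon}\right)$, solves $L(\partial)\psi^\varepsilon=F(x,\psi^\varepsilon)$ with $\psi^\varepsilon\left(-\frac1\varepsilon,x\right)=\varepsilon^\alpha A_-(\psi_-)\left(\frac{-1}{\varepsilon},x\right)+\varepsilon^\alpha r^\varepsilon(\varepsilon x)$. *)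

theory Defs
  imports
    "HOL-Analysis.Analysis"
    "HOL-Library.Poly_Mapping"
    "HOL-Probability.Essential_Supremum"
begin

text \<open>
  The space \<open>X\<close> is an abstract Banach space \<open>'x\<close> together with a map \<open>rep\<close> that picks, for every
  element of \<open>X\<close>, a representing function on \<open>\<real>\<^sup>n\<close> with values in \<open>\<complex>\<^sup>q\<close>.  Elements of \<open>X\<close> are
  functions modulo equality almost everywhere, so that Lebesgue and Sobolev spaces are covered.
  Lebesgue (not Borel) measurability is used throughout, which makes every notion below independent
  of the chosen representatives.
\<close>

definition in_space ::
    "('x \<Rightarrow> real^'n \<Rightarrow> complex^'q) \<Rightarrow> (real^'n \<Rightarrow> complex^'q) \<Rightarrow> bool" where
  "in_space rep f \<longleftrightarrow> (\<exists>\<phi>. AE x in lebesgue. rep \<phi> x = f x)"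

text \<open>The element of \<open>X\<close> given by a function, meaningful if \<open>in_space rep f\<close>.\<close>

definition of_fun ::
    "('x \<Rightarrow> real^'n \<Rightarrow> complex^'q) \<Rightarrow> (real^'n \<Rightarrow> complex^'q) \<Rightarrow> 'x" where
  "of_fun rep f = (THE \<phi>. AE x in lebesgue. rep \<phi> x = f x)"

text \<open>
  A complex Banach space of functions, continuously embedded in \<open>L\<^sup>1\<close>-loc (its elements are
  distributions, and convergence in \<open>X\<close> is compatible with convergence of functions).
\<close>

locale banach_function_space =
  fixes rep :: "'x::banach \<Rightarrow> real^'n \<Rightarrow> complex^'q"
  assumes rep_add: "AE x in lebesgue. rep (\<phi> + \<omega>) x = rep \<phi> x + rep \<omega> x"
    and rep_scaleR: "AE x in lebesgue. rep (a *\<^sub>R \<phi>) x = a *\<^sub>R rep \<phi> x"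
    and rep_inject: "(AE x in lebesgue. rep \<phi> x = rep \<omega> x) \<Longrightarrow> \<phi> = \<omega>"
    and complex_scale: "in_space rep (\<lambda>x. c *s rep \<phi> x)"
    and norm_complex_scale: "norm (of_fun rep (\<lambda>x. c *s rep \<phi> x)) = cmod c * norm \<phi>"
    and rep_locally_integrable: "compact K \<Longrightarrow> set_integrable lebesgue K (rep \<phi>)"
    and rep_embedding:
      "compact K \<Longrightarrow> \<exists>C. \<forall>\<phi>. (LINT x:K|lebesgue. norm (rep \<phi> x)) \<le> C * norm \<phi>"

definition dilation_invariant :: "('x \<Rightarrow> real^'n \<Rightarrow> complex^'q) \<Rightarrow> bool" where
  "dilation_invariant rep \<longleftrightarrow> (\<forall>\<phi>. \<forall>s>0. in_space rep (\<lambda>x. rep \<phi> (s *\<^sub>R x)))"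

definition dilate :: "('x \<Rightarrow> real^'n \<Rightarrow> complex^'q) \<Rightarrow> real \<Rightarrow> 'x \<Rightarrow> 'x" where
  "dilate rep s \<phi> = of_fun rep (\<lambda>x. rep \<phi> (s *\<^sub>R x))"

definition norm_eps ::
    "('x::real_normed_vector \<Rightarrow> real^'n \<Rightarrow> complex^'q) \<Rightarrow> real \<Rightarrow> real \<Rightarrow> 'x \<Rightarrow> real" where
  "norm_eps rep \<alpha> \<epsilon> \<phi> = norm ((\<epsilon> powr \<alpha>) *\<^sub>R dilate rep \<epsilon> \<phi>)"

definition pdiff ::
    "'n \<Rightarrow> (real^'n \<Rightarrow> 'b) \<Rightarrow> real^'n \<Rightarrow> 'b::real_normed_vector" where
  "pdiff i f = (\<lambda>x. frechet_derivative f (at x) (axis i 1))"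

definition pdiffs ::
    "'n list \<Rightarrow> (real^'n \<Rightarrow> 'b) \<Rightarrow> real^'n \<Rightarrow> 'b::real_normed_vector" where
  "pdiffs is f = foldr pdiff is f"

definition smooth :: "(real^'n \<Rightarrow> 'b::real_normed_vector) \<Rightarrow> bool" where
  "smooth f \<longleftrightarrow> (\<forall>is x. pdiffs is f differentiable at x)"

text \<open>
  The derivative for a multi-index.  The order in which the partial derivatives are taken is
  immaterial for smooth functions, the only ones to which this is applied.
\<close>

definition multi_diff ::
    "('n \<Rightarrow>\<^sub>0 nat) \<Rightarrow> (real^'n \<Rightarrow> 'b) \<Rightarrow> real^'n \<Rightarrow> 'b::real_normed_vector" where
  "multi_diff \<beta> f = pdiffs (SOME is. \<forall>i. count_list is i = Poly_Mapping.lookup \<beta> i) f"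

definition total_order :: "('n::finite \<Rightarrow>\<^sub>0 nat) \<Rightarrow> nat" where
  "total_order \<beta> = (\<Sum>i\<in>UNIV. Poly_Mapping.lookup \<beta> i)"

definition test_functions :: "(real^'n \<Rightarrow> real) set" where
  "test_functions = {\<theta>. smooth \<theta> \<and> compact (closure {x. \<theta> x \<noteq> 0})}"

definition schwartz_functions :: "(real^'n \<Rightarrow> complex^'q) set" where
  "schwartz_functions =
    {f. smooth f \<and> (\<forall>is k. \<exists>C. \<forall>x. norm x ^ k * norm (pdiffs is f x) \<le> C)}"

definition pairing :: "(real^'n \<Rightarrow> real) \<Rightarrow> (real^'n \<Rightarrow> complex^'q) \<Rightarrow> complex^'q" where
  "pairing \<theta> f = (LINT x|lebesgue. \<theta> x *\<^sub>R f x)"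

text \<open>
  For a matrix-valued polynomial \<open>P = \<Sum>\<^sub>\<beta> P\<^sub>\<beta> \<zeta>\<^sup>\<beta>\<close>, this is the action on the test function \<open>\<theta>\<close> of the
  distribution \<open>P(\<epsilon>\<partial>\<^sub>x) f\<close>: the derivatives are moved to \<open>\<theta>\<close>, whence the sign in \<open>(-\<epsilon>)\<close>.
\<close>

definition space_op ::
    "(('n \<Rightarrow>\<^sub>0 nat) \<Rightarrow>\<^sub>0 complex^'q^'q) \<Rightarrow> real \<Rightarrow> (real^'n \<Rightarrow> real) \<Rightarrow> (real^'n \<Rightarrow> complex^'q)
      \<Rightarrow> complex^'q" where
  "space_op P \<epsilon> \<theta> f =
    (\<Sum>\<beta>\<in>Poly_Mapping.keys P. (- \<epsilon>) ^ total_order \<beta> *\<^sub>R (Poly_Mapping.lookup P \<beta> *v pairing (multi_diff \<beta> \<theta>) f))"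

text \<open>
  Solutions in \<open>C(I; X)\<close>, \<open>I\<close> an interval, of \<open>\<epsilon> \<partial>\<^sub>t u + P(\<epsilon>\<partial>\<^sub>x) u = G(x, u)\<close> in the sense of
  distributions in \<open>x\<close>, integrated in time.  As the pairings of \<open>u(t)\<close> with test functions are
  continuous in \<open>t\<close>, this is the equation in the sense of distributions in \<open>(t, x)\<close>.
\<close>

definition solution ::
    "('x::banach \<Rightarrow> real^'n \<Rightarrow> complex^'q) \<Rightarrow> (('n \<Rightarrow>\<^sub>0 nat) \<Rightarrow>\<^sub>0 complex^'q^'q) \<Rightarrow> real
      \<Rightarrow> (real^'n \<Rightarrow> complex^'q \<Rightarrow> complex^'q) \<Rightarrow> real set \<Rightarrow> (real \<Rightarrow> 'x) \<Rightarrow> bool" where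
  "solution rep P \<epsilon> G I u \<longleftrightarrow>
    continuous_on I u \<and>
    (AE t in lebesgue. t \<in> I \<longrightarrow>
      (\<forall>K. compact K \<longrightarrow> set_integrable lebesgue K (\<lambda>x. G x (rep (u t) x)))) \<and>
    (\<forall>\<theta>\<in>test_functions. \<forall>a\<in>I. \<forall>b\<in>I. a \<le> b \<longrightarrow>
      set_integrable lebesgue {a..b} (\<lambda>t. pairing \<theta> (\<lambda>x. G x (rep (u t) x))) \<and>
      \<epsilon> *\<^sub>R (pairing \<theta> (rep (u b)) - pairing \<theta> (rep (u a)))
        + (LINT t:{a..b}|lebesgue. space_op P \<epsilon> \<theta> (rep (u t)))
      = (LINT t:{a..b}|lebesgue. pairing \<theta> (\<lambda>x. G x (rep (u t) x))))"

definition homogeneous :: "real \<Rightarrow> (real^'n \<Rightarrow> complex^'q \<Rightarrow> complex^'q) \<Rightarrow> bool" where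
  "homogeneous p F \<longleftrightarrow> (\<forall>x z. \<forall>s>0. F x (s *\<^sub>R z) = (s powr p) *\<^sub>R F x z)"

definition unitary_group ::
    "('x::banach \<Rightarrow> real^'n \<Rightarrow> complex^'q) \<Rightarrow> (real \<Rightarrow> 'x \<Rightarrow> 'x) \<Rightarrow> bool" where
  "unitary_group rep U \<longleftrightarrow>
    U 0 = id \<and> (\<forall>s t. U (s + t) = U s \<circ> U t) \<and>
    (\<forall>t. linear (U t) \<and> (\<forall>\<phi>. norm (U t \<phi>) = norm \<phi>) \<and>
      (\<forall>c \<phi>. U t (of_fun rep (\<lambda>x. c *s rep \<phi> x)) = of_fun rep (\<lambda>x. c *s rep (U t \<phi>) x)))"

definition Linf_norm :: "(real^'n \<Rightarrow> complex^'q) \<Rightarrow> ereal" where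
  "Linf_norm f = esssup lebesgue (\<lambda>x. ereal (norm (f x)))"

definition decay_constant ::
    "('x \<Rightarrow> real^'n \<Rightarrow> complex^'q) \<Rightarrow> (real \<Rightarrow> 'x \<Rightarrow> 'x) \<Rightarrow> real \<Rightarrow> real filter
      \<Rightarrow> (real^'n \<Rightarrow> complex^'q) \<Rightarrow> ereal" where
  "decay_constant rep U \<alpha> \<F> f =
    Limsup \<F> (\<lambda>t. ereal (\<bar>t\<bar> powr \<alpha>) * Linf_norm (rep (U t (of_fun rep f))))"

definition assumption1 ::
    "('x::banach \<Rightarrow> real^'n \<Rightarrow> complex^'q) \<Rightarrow> (('n \<Rightarrow>\<^sub>0 nat) \<Rightarrow>\<^sub>0 complex^'q^'q)
      \<Rightarrow> (real \<Rightarrow> 'x \<Rightarrow> 'x) \<Rightarrow> real \<Rightarrow> ('x \<Rightarrow> real \<Rightarrow> 'x) \<Rightarrow> ('x \<Rightarrow> real \<Rightarrow> 'x) \<Rightarrow> bool" where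
  "assumption1 rep P U \<alpha> A\<^sub>m A\<^sub>p \<longleftrightarrow>
    (\<forall>\<phi>. \<exists>!\<psi>. solution rep P 1 (\<lambda>x z. 0) UNIV \<psi> \<and> \<psi> 0 = \<phi>) \<and>
    unitary_group rep U \<and>
    (\<forall>\<psi>. solution rep P 1 (\<lambda>x z. 0) UNIV \<psi> \<longrightarrow> (\<forall>t. \<psi> t = U t (\<psi> 0))) \<and>
    \<alpha> \<ge> 0 \<and>
    (\<forall>f\<in>schwartz_functions. in_space rep f \<and>
      (\<exists>c::real. decay_constant rep U \<alpha> at_top f = ereal c) \<and>
      (\<exists>c::real. decay_constant rep U \<alpha> at_bot f = ereal c)) \<and>
    (\<exists>f\<in>schwartz_functions. decay_constant rep U \<alpha> at_top f \<noteq> 0) \<and>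
    (\<exists>f\<in>schwartz_functions. decay_constant rep U \<alpha> at_bot f \<noteq> 0) \<and>
    (\<forall>\<phi>. continuous_on UNIV (A\<^sub>m \<phi>) \<and> continuous_on UNIV (A\<^sub>p \<phi>) \<and>
      ((\<lambda>t. norm (\<phi> - U (- t) ((\<bar>t\<bar> powr (- \<alpha>)) *\<^sub>R A\<^sub>m \<phi> t))) \<longlongrightarrow> 0) at_bot \<and>
      ((\<lambda>t. norm (\<phi> - U (- t) ((\<bar>t\<bar> powr (- \<alpha>)) *\<^sub>R A\<^sub>p \<phi> t))) \<longlongrightarrow> 0) at_top)"

text \<open>The condition \<open>U\<^sub>0(-t) \<psi>(t) = \<omega>\<close> at \<open>t = t\<^sub>0\<close>, where \<open>t\<^sub>0 = -\<infinity>\<close> is allowed.\<close>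

definition data_at ::
    "(real \<Rightarrow> 'x \<Rightarrow> 'x) \<Rightarrow> ereal \<Rightarrow> 'x \<Rightarrow> (real \<Rightarrow> 'x::real_normed_vector) \<Rightarrow> bool" where
  "data_at U t\<^sub>0 \<omega> \<psi> \<longleftrightarrow>
    (if t\<^sub>0 = -\<infinity> then ((\<lambda>t. U (- t) (\<psi> t)) \<longlongrightarrow> \<omega>) at_bot
     else U (- real_of_ereal t\<^sub>0) (\<psi> (real_of_ereal t\<^sub>0)) = \<omega>)"

text \<open>
  For the continuous dependence, \<open>C(]-\<infinity>, -T]; X)\<close> carries its usual topology of uniform
  convergence on compact sets, and \<open>t\<^sub>0\<close> varies in \<open>[-\<infinity>, -T]\<close> with the topology of the extended reals.
\<close>

definition assumption2 ::
    "('x::banach \<Rightarrow> real^'n \<Rightarrow> complex^'q) \<Rightarrow> (('n \<Rightarrow>\<^sub>0 nat) \<Rightarrow>\<^sub>0 complex^'q^'q)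
      \<Rightarrow> (real^'n \<Rightarrow> complex^'q \<Rightarrow> complex^'q) \<Rightarrow> (real \<Rightarrow> 'x \<Rightarrow> 'x) \<Rightarrow> bool" where
  "assumption2 rep P F U \<longleftrightarrow>
    (\<forall>\<psi>\<^sub>m. \<exists>T::real. \<forall>t\<^sub>0\<le>ereal (- T). \<exists>\<psi>.
      solution rep P 1 F {..-T} \<psi> \<and> data_at U t\<^sub>0 \<psi>\<^sub>m \<psi> \<and>
      (\<forall>\<psi>'. solution rep P 1 F {..-T} \<psi>' \<and> data_at U t\<^sub>0 \<psi>\<^sub>m \<psi>' \<longrightarrow> (\<forall>t\<le>-T. \<psi>' t = \<psi> t)) \<and>
      (\<forall>a. \<forall>\<eta>>0. \<forall>\<^sub>F (\<omega>, t\<^sub>1) in nhds (\<psi>\<^sub>m, t\<^sub>0). t\<^sub>1 \<le> ereal (- T) \<longrightarrow>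
        (\<forall>\<psi>'. solution rep P 1 F {..-T} \<psi>' \<and> data_at U t\<^sub>1 \<omega> \<psi>' \<longrightarrow>
          (\<forall>t\<in>{a..-T}. norm (\<psi>' t - \<psi> t) < \<eta>))) \<and>
      continuous_on {..-T} (\<lambda>t. U (- t) (\<psi> t)) \<and>
      (\<exists>l. ((\<lambda>t. U (- t) (\<psi> t)) \<longlongrightarrow> l) at_bot))"

text \<open>
  For the uniform continuity, the functions \<open>U\<^sub>0(-t) \<psi>(t)\<close> are compared in the norm of uniform
  convergence on \<open>\<real>\<close>; by the last clause they have limits at \<open>\<plusminus>\<infinity>\<close>, hence are bounded.
\<close>

definition assumption3 ::
    "('x::banach \<Rightarrow> real^'n \<Rightarrow> complex^'q) \<Rightarrow> (('n \<Rightarrow>\<^sub>0 nat) \<Rightarrow>\<^sub>0 complex^'q^'q)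
      \<Rightarrow> (real^'n \<Rightarrow> complex^'q \<Rightarrow> complex^'q) \<Rightarrow> (real \<Rightarrow> 'x \<Rightarrow> 'x) \<Rightarrow> bool" where
  "assumption3 rep P F U \<longleftrightarrow>
    (\<forall>R>0.
      (\<forall>\<phi>\<in>ball 0 R. \<exists>!\<psi>. solution rep P 1 F UNIV \<psi> \<and> \<psi> 0 = \<phi>) \<and>
      (\<forall>\<eta>>0. \<exists>\<delta>>0. \<forall>\<psi> \<psi>'.
        solution rep P 1 F UNIV \<psi> \<and> solution rep P 1 F UNIV \<psi>' \<and>
        \<psi> 0 \<in> ball 0 R \<and> \<psi>' 0 \<in> ball 0 R \<and> norm (\<psi> 0 - \<psi>' 0) < \<delta> \<longrightarrow>
        (\<forall>t. norm (U (- t) (\<psi> t) - U (- t) (\<psi>' t)) \<le> \<eta>))) \<and>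
    (\<forall>\<psi>. solution rep P 1 F UNIV \<psi> \<longrightarrow>
      (\<exists>\<psi>\<^sub>m. ((\<lambda>t. norm (U (- t) (\<psi> t) - \<psi>\<^sub>m)) \<longlongrightarrow> 0) at_bot) \<and>
      (\<exists>\<psi>\<^sub>p. ((\<lambda>t. norm (U (- t) (\<psi> t) - \<psi>\<^sub>p)) \<longlongrightarrow> 0) at_top))"

text \<open>The wave operators: \<open>W\<^sub>-\<close> and \<open>W\<^sub>+\<close> are obtained for the filters \<open>at_bot\<close> and \<open>at_top\<close>.\<close>

definition wave_operator ::
    "('x::banach \<Rightarrow> real^'n \<Rightarrow> complex^'q) \<Rightarrow> (('n \<Rightarrow>\<^sub>0 nat) \<Rightarrow>\<^sub>0 complex^'q^'q)
      \<Rightarrow> (real^'n \<Rightarrow> complex^'q \<Rightarrow> complex^'q) \<Rightarrow> (real \<Rightarrow> 'x \<Rightarrow> 'x) \<Rightarrow> real filter \<Rightarrow> 'x \<Rightarrow> 'x" where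
  "wave_operator rep P F U \<F> \<omega> =
    (THE \<phi>. \<exists>\<psi>. solution rep P 1 F UNIV \<psi> \<and> ((\<lambda>t. U (- t) (\<psi> t)) \<longlongrightarrow> \<omega>) \<F> \<and> \<psi> 0 = \<phi>)"

definition scattering_operator ::
    "('x::banach \<Rightarrow> real^'n \<Rightarrow> complex^'q) \<Rightarrow> (('n \<Rightarrow>\<^sub>0 nat) \<Rightarrow>\<^sub>0 complex^'q^'q)
      \<Rightarrow> (real^'n \<Rightarrow> complex^'q \<Rightarrow> complex^'q) \<Rightarrow> (real \<Rightarrow> 'x \<Rightarrow> 'x) \<Rightarrow> 'x \<Rightarrow> 'x" where
  "scattering_operator rep P F U \<psi>\<^sub>m =
    (THE \<psi>\<^sub>p. \<exists>\<psi>. solution rep P 1 F UNIV \<psi> \<and>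
      ((\<lambda>t. U (- t) (\<psi> t)) \<longlongrightarrow> \<psi>\<^sub>m) at_bot \<and> ((\<lambda>t. U (- t) (\<psi> t)) \<longlongrightarrow> \<psi>\<^sub>p) at_top)"

text \<open>
  Solutions in \<open>C(\<real>\<^sub>+; X)\<close> of the semiclassical Cauchy problem; \<open>A\<close> stands for
  \<open>A\<^sub>-(\<psi>\<^sub>-)\<close> and \<open>r\<close> for \<open>r\<^sup>\<epsilon>\<close>.
\<close>

definition semiclassical_solution ::
    "('x::banach \<Rightarrow> real^'n \<Rightarrow> complex^'q) \<Rightarrow> (('n \<Rightarrow>\<^sub>0 nat) \<Rightarrow>\<^sub>0 complex^'q^'q)
      \<Rightarrow> (real^'n \<Rightarrow> complex^'q \<Rightarrow> complex^'q) \<Rightarrow> real \<Rightarrow> real \<Rightarrow> (real \<Rightarrow> 'x) \<Rightarrow> 'x \<Rightarrow> real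
      \<Rightarrow> (real \<Rightarrow> 'x) \<Rightarrow> bool" where
  "semiclassical_solution rep P F p \<alpha> A r \<epsilon> u \<longleftrightarrow>
    solution rep P \<epsilon> (\<lambda>x z. (\<epsilon> powr (\<alpha> * (p - 1))) *\<^sub>R F ((1 / \<epsilon>) *\<^sub>R x) z) {0..} u \<and>
    u 0 = dilate rep (1 / \<epsilon>) (A (- 1 / \<epsilon>)) + r"

end

theory Submission
  imports Defs
begin

text \<open>
  The semiclassical problem is the problem \<open>L(\<partial>)\<psi> = F(x, \<psi>)\<close> seen through the substitution
  \<open>u(t) = \<epsilon>\<^sup>-\<^sup>\<alpha> \<psi>((t - 1)/\<epsilon>, \<cdot>/\<epsilon>)\<close>; the factor \<open>\<epsilon>\<^sup>\<alpha>\<^sup>(\<^sup>p\<^sup>-\<^sup>1\<^sup>)\<close> in front of the nonlinearity is what its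
  homogeneity requires.  The norm \<open>norm_eps\<close> undoes the substitution, so the theorem is a statement
  on the solutions \<open>\<psi>\<^sup>\<epsilon>\<close> of one fixed equation, with data given at the time \<open>-1/\<epsilon>\<close>.

  That equation is autonomous in time.  Hence global well-posedness for data at \<open>t = 0\<close> gives it for
  data at any time, and solutions on half lines are restrictions of global ones
  (\<open>solution_translate\<close>, \<open>solution_glue\<close>).  This yields existence and uniqueness of \<open>u\<^sup>\<epsilon>\<close> for all
  \<open>\<epsilon> > 0\<close>.

  For the asymptotics, let \<open>\<psi>\<close> be the solution with \<open>U(-t) \<psi>(t) \<rightarrow> \<psi>\<^sub>-\<close> at \<open>-\<infinity>\<close>.  By the choice of
  \<open>A\<^sub>-\<close> and the smallness of \<open>r\<^sup>\<epsilon>\<close>, \<open>U(1/\<epsilon>) \<psi>\<^sup>\<epsilon>(-1/\<epsilon>)\<close> tends to \<open>\<psi>\<^sub>-\<close> as well.  Continuous dependence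
  on data at times close to \<open>-\<infinity>\<close> gives \<open>\<psi>\<^sup>\<epsilon>(-T) \<rightarrow> \<psi>(-T)\<close> for one fixed time \<open>-T\<close>, and the
  time-uniform continuity of the global flow, started at \<open>-T\<close>, turns this into
  \<open>\<psi>\<^sup>\<epsilon> \<rightarrow> \<psi>\<close> uniformly on the whole real line (\<open>uniform_convergence_to_incoming\<close>).  All three
  asymptotic statements follow: \<open>\<psi>(0)\<close> is the caustic profile \<open>W\<^sub>- \<psi>\<^sub>-\<close>, and \<open>\<psi>(s)\<close> is close to
  \<open>|s|\<^sup>-\<^sup>\<alpha> A\<^sub>-(\<psi>\<^sub>-)(s)\<close> for \<open>s \<rightarrow> -\<infinity>\<close> and to \<open>|s|\<^sup>-\<^sup>\<alpha> A\<^sub>+(S \<psi>\<^sub>-)(s)\<close> for \<open>s \<rightarrow> \<infinity>\<close>, while times \<open>t \<le> \<tau> < 1\<close> and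
  \<open>t \<ge> \<tau> > 1\<close> correspond to \<open>s = (t - 1)/\<epsilon>\<close> in neighbourhoods of \<open>-\<infinity>\<close> and \<open>\<infinity>\<close> that shrink with \<open>\<epsilon>\<close>.

  The substitution has to map \<open>C(I; X)\<close> to itself, that is, dilations must be continuous on \<open>X\<close>.  As
  only invariance of \<open>X\<close> is given, this comes from the closed graph theorem
  (\<open>bounded_linear_dilate\<close>), applied with the embedding of \<open>X\<close> into the locally integrable functions.
\<close>

section \<open>Affine substitutions in Lebesgue integrals\<close>

lemma
  fixes t :: "'a::euclidean_space"
  assumes "s \<noteq> 0"
  shows lebesgue_eq_affine:
      "lebesgue = density (distr lebesgue lebesgue (\<lambda>x. t + s *\<^sub>R x)) (\<lambda>_. ennreal (\<bar>s\<bar> ^ DIM('a)))"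
    and measurable_lebesgue_affine: "(\<lambda>x. t + s *\<^sub>R x) \<in> lebesgue \<rightarrow>\<^sub>M lebesgue"
proof -
  have eq: "(\<lambda>x. t + (\<Sum>j\<in>Basis. (s * (x \<bullet> j)) *\<^sub>R j)) = (\<lambda>x. t + s *\<^sub>R x)"
    by (simp add: fun_eq_iff scaleR_scaleR[symmetric] scaleR_sum_right[symmetric] euclidean_representation
        del: scaleR_scaleR)
  show "lebesgue = density (distr lebesgue lebesgue (\<lambda>x. t + s *\<^sub>R x)) (\<lambda>_. ennreal (\<bar>s\<bar> ^ DIM('a)))"
    using lebesgue_affine_euclidean[of "\<lambda>_. s" t] assms by (simp add: eq)
  show "(\<lambda>x. t + s *\<^sub>R x) \<in> lebesgue \<rightarrow>\<^sub>M lebesgue"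
    using lebesgue_affine_measurable[of "\<lambda>_. s" t] assms by (simp add: eq)
qed

lemma AE_lebesgue_affine:
  fixes t :: "'a::euclidean_space"
  assumes "s \<noteq> 0" and "AE x in lebesgue. Q x"
  shows "AE x in lebesgue. Q (t + s *\<^sub>R x)"
proof -
  have "AE x in density (distr lebesgue lebesgue (\<lambda>x. t + s *\<^sub>R x)) (\<lambda>_. ennreal (\<bar>s\<bar> ^ DIM('a))). Q x"
    using assms(2) by (subst lebesgue_eq_affine[OF assms(1), symmetric])
  then have "AE x in distr lebesgue lebesgue (\<lambda>x. t + s *\<^sub>R x). Q x"
    using \<open>s \<noteq> 0\<close> by (subst (asm) AE_density) auto
  then show ?thesis
    by (rule AE_distrD[OF measurable_lebesgue_affine[OF \<open>s \<noteq> 0\<close>]])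
qed

lemma
  fixes t :: "'a::euclidean_space" and f :: "'a \<Rightarrow> 'b::{banach, second_countable_topology}"
  assumes "s \<noteq> 0" and "integrable lebesgue f"
  shows integrable_lebesgue_affine: "integrable lebesgue (\<lambda>x. f (t + s *\<^sub>R x))"
    and integral_lebesgue_affine_integrable:
      "(LINT x|lebesgue. f x) = \<bar>s\<bar> ^ DIM('a) *\<^sub>R (LINT x|lebesgue. f (t + s *\<^sub>R x))"
proof -
  let ?T = "\<lambda>x. t + s *\<^sub>R x"
  let ?d = "\<bar>s\<bar> ^ DIM('a)"
  note [measurable] = measurable_lebesgue_affine[OF \<open>s \<noteq> 0\<close>, of t]
  have f[measurable]: "f \<in> borel_measurable lebesgue"
    using assms(2) by simp
  have d: "?d \<noteq> 0"
    using assms(1) by simp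
  have "integrable (density (distr lebesgue lebesgue ?T) (\<lambda>_. ennreal ?d)) f"
    using assms(2) by (simp add: lebesgue_eq_affine[OF assms(1), symmetric])
  then have "integrable (distr lebesgue lebesgue ?T) (\<lambda>x. ?d *\<^sub>R f x)"
    by (subst (asm) integrable_density) auto
  then have "integrable (distr lebesgue lebesgue ?T) f"
    using d integrable_scaleR_right[of "1 / ?d" _ "\<lambda>x. ?d *\<^sub>R f x"] by simp
  then show "integrable lebesgue (\<lambda>x. f (?T x))"
    by (subst (asm) integrable_distr_eq) auto
  have "(LINT x|lebesgue. f x) = (LINT x|density (distr lebesgue lebesgue ?T) (\<lambda>_. ennreal ?d). f x)"
    using assms(2) by (simp add: lebesgue_eq_affine[OF assms(1), symmetric])
  also have "\<dots> = (LINT x|distr lebesgue lebesgue ?T. ?d *\<^sub>R f x)"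
    by (subst integral_density) auto
  also have "\<dots> = ?d *\<^sub>R (LINT x|lebesgue. f (?T x))"
    by (subst integral_distr) auto
  finally show "(LINT x|lebesgue. f x) = ?d *\<^sub>R (LINT x|lebesgue. f (?T x))" .
qed

lemma integrable_lebesgue_affine_iff:
  fixes t :: "'a::euclidean_space" and f :: "'a \<Rightarrow> 'b::{banach, second_countable_topology}"
  assumes "s \<noteq> 0"
  shows "integrable lebesgue (\<lambda>x. f (t + s *\<^sub>R x)) \<longleftrightarrow> integrable lebesgue f"
proof
  assume "integrable lebesgue (\<lambda>x. f (t + s *\<^sub>R x))"
  from integrable_lebesgue_affine[OF _ this, of "1 / s" "- (1 / s) *\<^sub>R t"] assms
  show "integrable lebesgue f"
    by (simp add: algebra_simps)
qed (rule integrable_lebesgue_affine[OF assms])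

text \<open>
  As the substitution is invertible, the two integrands are integrable together; if they are not,
  both integrals have the default value \<open>0\<close>.
\<close>
lemma integral_lebesgue_affine:
  fixes t :: "'a::euclidean_space" and f :: "'a \<Rightarrow> 'b::{banach, second_countable_topology}"
  assumes "s \<noteq> 0"
  shows "(LINT x|lebesgue. f (t + s *\<^sub>R x)) = (1 / \<bar>s\<bar> ^ DIM('a)) *\<^sub>R (LINT x|lebesgue. f x)"
proof (cases "integrable lebesgue f")
  case True
  from integral_lebesgue_affine_integrable[OF assms this, of t] assms show ?thesis
    by simp
next
  case False
  with integrable_lebesgue_affine_iff[OF assms, of f t] show ?thesis
    by (simp add: not_integrable_integral_eq)
qed

text \<open>
  The Lebesgue measure is complete, so a function that agrees almost everywhere with a measurable one
  is itself measurable; hence both functions are integrable or none is.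
\<close>
lemma
  fixes f g :: "'a::euclidean_space \<Rightarrow> 'b::euclidean_space"
  assumes "AE x in lebesgue. f x = g x"
  shows integrable_lebesgue_cong_AE: "integrable lebesgue f \<longleftrightarrow> integrable lebesgue g"
    and integral_lebesgue_cong_AE: "(LINT x|lebesgue. f x) = (LINT x|lebesgue. g x)"
proof -
  have sym: "AE x in lebesgue. g x = f x"
    using assms by eventually_elim simp
  show iff: "integrable lebesgue f \<longleftrightarrow> integrable lebesgue g"
  proof
    assume "integrable lebesgue f"
    then show "integrable lebesgue g"
      using borel_measurable_AE[OF _ assms] assms by (auto intro: integrable_cong_AE_imp)
  next
    assume "integrable lebesgue g"
    then show "integrable lebesgue f"
      using borel_measurable_AE[OF _ sym] sym by (auto intro: integrable_cong_AE_imp)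
  qed
  show "(LINT x|lebesgue. f x) = (LINT x|lebesgue. g x)"
  proof (cases "integrable lebesgue f")
    case True
    with iff assms show ?thesis
      by (intro integral_cong_AE) auto
  next
    case False
    with iff show ?thesis
      by (simp add: not_integrable_integral_eq)
  qed
qed

section \<open>The closed graph theorem\<close>

text \<open>
  Successive approximation: the error left by an approximation of \<open>x\<close> is approximated in turn.  The
  approximations add up to \<open>x\<close>, and their images form a geometrically convergent series, whose sum is
  \<open>f x\<close> because the graph is closed.
\<close>
lemma approximate_preimages_imp_bound:
  fixes f :: "'a::banach \<Rightarrow> 'b::banach"
  assumes "linear f"
    and closed_graph: "\<And>X x y. X \<longlonglongrightarrow> x \<Longrightarrow> (\<lambda>n. f (X n)) \<longlonglongrightarrow> y \<Longrightarrow> f x = y"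
    and approx: "\<And>x. \<exists>y. norm (x - y) \<le> norm x / 2 \<and> norm (f y) \<le> K * norm x"
    and "K \<ge> 0"
  shows "norm (f x) \<le> 2 * K * norm x"
proof -
  interpret linear f by fact
  obtain h where h: "\<And>x. norm (x - h x) \<le> norm x / 2" "\<And>x. norm (f (h x)) \<le> K * norm x"
    using approx by metis
  define R where "R n = ((\<lambda>x. x - h x) ^^ n) x" for n
  have R_Suc: "R (Suc n) = R n - h (R n)" and R_0: "R 0 = x" for n
    by (simp_all add: R_def)
  have R_bound: "norm (R n) \<le> norm x * (1 / 2) ^ n" for n
  proof (induction n)
    case (Suc n)
    then show ?case
      using h(1)[of "R n"] by (simp add: R_Suc)
  qed (simp add: R_0)
  have telescope: "(\<Sum>k<n. h (R k)) = x - R n" for n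
    by (induction n) (simp_all add: R_0 R_Suc)
  have "R \<longlonglongrightarrow> 0"
  proof (rule Lim_null_comparison)
    show "\<forall>\<^sub>F n in sequentially. norm (R n) \<le> norm x * (1 / 2) ^ n"
      using R_bound by simp
    show "(\<lambda>n. norm x * (1 / 2) ^ n) \<longlonglongrightarrow> 0"
      by (intro tendsto_mult_right_zero LIMSEQ_power_zero) simp
  qed
  then have lim: "(\<lambda>n. \<Sum>k<n. h (R k)) \<longlonglongrightarrow> x"
    using tendsto_diff[OF tendsto_const[of x] \<open>R \<longlonglongrightarrow> 0\<close>] by (simp add: telescope)
  let ?g = "\<lambda>k. K * norm x * (1 / 2) ^ k"
  have fh: "norm (f (h (R k))) \<le> ?g k" for k
    using h(2)[of "R k"] mult_left_mono[OF R_bound[of k] \<open>K \<ge> 0\<close>] by (simp add: mult.assoc)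
  have g: "summable ?g" "suminf ?g = 2 * K * norm x"
    by (simp_all add: suminf_mult suminf_geometric)
  have summable: "summable (\<lambda>k. f (h (R k)))" "summable (\<lambda>k. norm (f (h (R k))))"
    by (rule summable_comparison_test'[OF g(1)], use fh in simp)+
  have "(\<lambda>n. f (\<Sum>k<n. h (R k))) \<longlonglongrightarrow> suminf (\<lambda>k. f (h (R k)))"
    using summable_LIMSEQ[OF summable(1)] by (simp add: sum)
  from closed_graph[OF lim this] have "norm (f x) \<le> suminf (\<lambda>k. norm (f (h (R k))))"
    using summable_norm[OF summable(2)] by simp
  also have "\<dots> \<le> suminf ?g"
    using fh summable(2) g(1) by (intro suminf_le) auto
  finally show ?thesis
    by (simp add: g)
qed

text \<open>
  The closures of the sets where \<open>norm (f x) \<le> n\<close> cover the space, so by Baire's theorem one of them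
  contains a ball.  By symmetry and convexity it contains a ball around \<open>0\<close>, which after
  scaling is the approximation property of the previous lemma.
\<close>
theorem closed_graph_imp_bounded_linear:
  fixes f :: "'a::banach \<Rightarrow> 'b::banach"
  assumes "linear f"
    and closed_graph: "\<And>X x y. X \<longlonglongrightarrow> x \<Longrightarrow> (\<lambda>n. f (X n)) \<longlonglongrightarrow> y \<Longrightarrow> f x = y"
  shows "bounded_linear f"
proof -
  interpret linear f by fact
  let ?E = "\<lambda>n::nat. {x. norm (f x) \<le> real n}"
  have union: "(\<Union>n. closure (?E n)) = UNIV"
  proof -
    have "x \<in> ?E (nat \<lceil>norm (f x)\<rceil>)" for x
      by (simp add: of_nat_ceiling)
    then show ?thesis
      using closure_subset by blast
  qed
  have "\<exists>n. interior (closure (?E n)) \<noteq> {}"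
  proof (rule ccontr)
    assume "\<not> ?thesis"
    then have "euclidean interior_of (\<Union>(range (\<lambda>n. closure (?E n)))) = {}"
      using completely_metrizable_space_euclidean
      by (intro Baire_category_alt) (auto simp: interior_of_def interior_def)
    then show False
      by (simp add: union)
  qed
  then obtain n x0 where "x0 \<in> interior (closure (?E n))"
    by blast
  then obtain d where d: "d > 0" "cball x0 d \<subseteq> closure (?E n)"
    by (auto simp: mem_interior_cball)
  have ball: "\<exists>y. norm (x - y) < e \<and> norm (f y) \<le> real n" if "norm x \<le> d" "e > 0" for x e
  proof -
    have "x0 + x \<in> closure (?E n)" "x0 - x \<in> closure (?E n)"
      using that d by (auto simp: dist_norm subset_iff)
    then obtain y z where y: "norm (f y) \<le> real n" "dist y (x0 + x) < e"
      and z: "norm (f z) \<le> real n" "dist z (x0 - x) < e"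
      using \<open>e > 0\<close> unfolding closure_approachable by blast
    \<comment> \<open>As \<open>y\<close> approximates \<open>x0 + x\<close> and \<open>z\<close> approximates \<open>x0 - x\<close>, half their difference approximates \<open>x\<close>.\<close>
    let ?w = "(1 / 2) *\<^sub>R (y - z)"
    have "f ?w = (1 / 2) *\<^sub>R (f y - f z)"
      by (simp add: scale diff)
    then have "norm (f ?w) \<le> real n"
      using y(1) z(1) norm_triangle_ineq4[of "f y" "f z"] by simp
    moreover have "x - ?w = (1 / 2) *\<^sub>R ((x0 + x - y) - (x0 - x - z))"
      by (simp add: algebra_simps flip: scaleR_add_left)
    then have "norm (x - ?w) < e"
      using y(2) z(2) norm_triangle_ineq4[of "x0 + x - y" "x0 - x - z"]
      by (simp add: dist_norm norm_minus_commute)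
    ultimately show ?thesis
      by blast
  qed
  have approx: "\<exists>y. norm (x - y) \<le> norm x / 2 \<and> norm (f y) \<le> (real n / d) * norm x" for x
  proof (cases "x = 0")
    case True
    then show ?thesis
      by (auto intro!: exI[of _ 0] simp: zero)
  next
    case False
    let ?r = "d / norm x"
    have r: "?r > 0"
      using False d by simp
    have "norm (?r *\<^sub>R x) \<le> d"
      using False d by simp
    from ball[OF this, of "d / 2"] d obtain y
      where y: "norm (?r *\<^sub>R x - y) < d / 2" "norm (f y) \<le> real n"
      by auto
    let ?y = "(1 / ?r) *\<^sub>R y"
    have "x - ?y = (1 / ?r) *\<^sub>R (?r *\<^sub>R x - y)"
      using False d by (simp add: scaleR_diff_right)
    then have "norm (x - ?y) = (norm x / d) * norm (?r *\<^sub>R x - y)"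
      using d by simp
    also have "\<dots> \<le> (norm x / d) * (d / 2)"
      using y(1) d by (intro mult_left_mono) auto
    finally have "norm (x - ?y) \<le> norm x / 2"
      using d by simp
    moreover have "norm (f ?y) \<le> (real n / d) * norm x"
      using mult_right_mono[OF y(2), of "norm x"] d by (simp add: scale field_simps)
    ultimately show ?thesis
      by blast
  qed
  show ?thesis
  proof (rule bounded_linear_intro[where K = "2 * (real n / d)"])
    show "norm (f x) \<le> norm x * (2 * (real n / d))" for x
    proof -
      have "norm (f x) \<le> 2 * (real n / d) * norm x"
      proof (rule approximate_preimages_imp_bound[OF \<open>linear f\<close>])
        show "f x = y" if "X \<longlonglongrightarrow> x" "(\<lambda>n. f (X n)) \<longlonglongrightarrow> y" for X x y
          using that by (rule closed_graph)
      qed (use approx d in auto)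
      then show ?thesis
        by (simp only: mult.commute)
    qed
  qed (simp_all add: add scale)
qed

section \<open>Derivatives of dilated test functions\<close>

lemma pdiffs_Nil [simp]: "pdiffs [] f = f"
  by (simp add: pdiffs_def)

lemma pdiffs_Cons: "pdiffs (i # is) f = pdiff i (pdiffs is f)"
  by (simp add: pdiffs_def)

lemma pdiffs_dilate:
  fixes f :: "real^'n \<Rightarrow> 'b::real_normed_vector"
  assumes "smooth f"
  shows "pdiffs is (\<lambda>x. f (s *\<^sub>R x)) = (\<lambda>x. s ^ length is *\<^sub>R pdiffs is f (s *\<^sub>R x))"
proof (induction "is")
  case (Cons i "is")
  have "((\<lambda>x. s ^ length is *\<^sub>R pdiffs is f (s *\<^sub>R x)) has_derivative
      (\<lambda>h. s ^ length is *\<^sub>R frechet_derivative (pdiffs is f) (at (s *\<^sub>R x)) (s *\<^sub>R h))) (at x)" for x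
  proof -
    have "pdiffs is f differentiable at (s *\<^sub>R x)"
      using assms by (simp add: smooth_def)
    then have *: "(pdiffs is f has_derivative frechet_derivative (pdiffs is f) (at (s *\<^sub>R x))) (at (s *\<^sub>R x))"
      by (simp add: frechet_derivative_works)
    have **: "((\<lambda>x. s *\<^sub>R x) has_derivative (\<lambda>h. s *\<^sub>R h)) (at x)"
      by (auto intro!: derivative_eq_intros)
    show ?thesis
      using has_derivative_scaleR_right[OF has_derivative_compose[OF ** *], of "s ^ length is"] .
  qed
  then have "frechet_derivative (\<lambda>x. s ^ length is *\<^sub>R pdiffs is f (s *\<^sub>R x)) (at x) =
      (\<lambda>h. s ^ length is *\<^sub>R frechet_derivative (pdiffs is f) (at (s *\<^sub>R x)) (s *\<^sub>R h))" for x
    by (rule frechet_derivative_at[symmetric])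
  moreover have "frechet_derivative (pdiffs is f) (at y) (s *\<^sub>R h) = s *\<^sub>R frechet_derivative (pdiffs is f) (at y) h"
    for y h
    using assms by (intro linear_scale linear_frechet_derivative) (simp add: smooth_def)
  ultimately show ?case
    unfolding pdiffs_Cons Cons.IH pdiff_def
    by (simp add: mult.commute)
qed simp

lemma smooth_dilate:
  fixes f :: "real^'n \<Rightarrow> 'b::real_normed_vector"
  assumes "smooth f"
  shows "smooth (\<lambda>x. f (s *\<^sub>R x))"
  unfolding smooth_def
proof (intro allI)
  fix "is" :: "'n list" and x :: "real^'n"
  have "pdiffs is f differentiable at (s *\<^sub>R x)"
    using assms by (simp add: smooth_def)
  moreover have "(\<lambda>x. s *\<^sub>R x) differentiable at x"
    by simp
  ultimately have "(pdiffs is f \<circ> (\<lambda>x. s *\<^sub>R x)) differentiable at x"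
    by (intro differentiable_chain_at) auto
  then show "pdiffs is (\<lambda>x. f (s *\<^sub>R x)) differentiable at x"
    unfolding pdiffs_dilate[OF assms] by (intro differentiable_scaleR) (auto simp: o_def)
qed

lemma test_functions_dilate:
  assumes "\<theta> \<in> test_functions" "s \<noteq> 0"
  shows "(\<lambda>x. \<theta> (s *\<^sub>R x)) \<in> test_functions"
proof -
  let ?S = "{x. \<theta> x \<noteq> 0}"
  have "{x. \<theta> (s *\<^sub>R x) \<noteq> 0} = (\<lambda>x. (1 / s) *\<^sub>R x) ` ?S"
    using \<open>s \<noteq> 0\<close> by (force simp: image_iff intro: exI[of _ "s *\<^sub>R _"])
  then have "closure {x. \<theta> (s *\<^sub>R x) \<noteq> 0} = (\<lambda>x. (1 / s) *\<^sub>R x) ` closure ?S"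
    by (simp add: closure_scaleR)
  moreover have "compact ((\<lambda>x. (1 / s) *\<^sub>R x) ` closure ?S)"
    using assms(1) by (intro compact_scaling) (simp add: test_functions_def)
  ultimately show ?thesis
    using assms(1) by (simp add: test_functions_def smooth_dilate del: compact_closure)
qed

lemma pdiffs_eq_0_outside_support:
  fixes f :: "real^'n \<Rightarrow> 'b::real_normed_vector"
  assumes "x \<notin> closure {x. f x \<noteq> 0}"
  shows "pdiffs is f x = 0"
  using assms
proof (induction "is" arbitrary: x)
  case Nil
  then show ?case
    using closure_subset[of "{x. f x \<noteq> 0}"] by auto
next
  case (Cons i "is")
  have "(pdiffs is f has_derivative (\<lambda>_. 0)) (at x)"
  proof (rule has_derivative_transform_within_open)
    show "((\<lambda>_. 0) has_derivative (\<lambda>_. 0)) (at x)"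
      by simp
    show "open (- closure {x. f x \<noteq> 0})"
      by (intro open_Compl closed_closure)
  qed (use Cons in auto)
  then show ?case
    by (simp add: pdiffs_Cons pdiff_def frechet_derivative_at[symmetric])
qed

text \<open>
  The list of indices that \<open>multi_diff\<close> picks exists, and any such list has the order of the
  multi-index as its length; this is the power of \<open>s\<close> that a dilation by \<open>s\<close> produces.
\<close>
lemma length_multi_index_list:
  fixes \<beta> :: "'n::finite \<Rightarrow>\<^sub>0 nat"
  shows "length (SOME is. \<forall>i. count_list is i = Poly_Mapping.lookup \<beta> i) = total_order \<beta>"
proof -
  define "is" where "is = (SOME is. \<forall>i. count_list is i = Poly_Mapping.lookup \<beta> i)"
  obtain xs :: "'n list" where xs: "mset xs = (\<Sum>i\<in>UNIV. replicate_mset (Poly_Mapping.lookup \<beta> i) i)"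
    using ex_mset by blast
  have "count_list xs i = Poly_Mapping.lookup \<beta> i" for i
    unfolding count_mset[symmetric] xs by (simp add: count_sum sum.delta')
  then have "\<exists>is. \<forall>i. count_list is i = Poly_Mapping.lookup \<beta> i"
    by blast
  then have "\<forall>i. count_list is i = Poly_Mapping.lookup \<beta> i"
    unfolding is_def by (rule someI_ex)
  moreover have "length is = (\<Sum>i\<in>UNIV. count_list is i)"
    using sum_count_set[of "is" UNIV] by simp
  ultimately show ?thesis
    by (simp add: total_order_def flip: is_def)
qed

lemma multi_diff_dilate:
  fixes f :: "real^'n \<Rightarrow> 'b::real_normed_vector"
  assumes "smooth f"
  shows "multi_diff \<beta> (\<lambda>x. f (s *\<^sub>R x)) = (\<lambda>x. s ^ total_order \<beta> *\<^sub>R multi_diff \<beta> f (s *\<^sub>R x))"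
  by (simp add: multi_diff_def pdiffs_dilate[OF assms] length_multi_index_list)

lemma continuous_multi_diff:
  fixes f :: "real^'n \<Rightarrow> 'b::real_normed_vector"
  assumes "smooth f"
  shows "continuous_on UNIV (multi_diff \<beta> f)"
  unfolding multi_diff_def
  using assms by (intro continuous_at_imp_continuous_on) (auto simp: smooth_def intro: differentiable_imp_continuous_within)

section \<open>Dilations of a Banach function space\<close>

context banach_function_space
begin

lemma of_fun_eqI:
  assumes "AE x in lebesgue. rep \<phi> x = f x"
  shows "of_fun rep f = \<phi>"
  unfolding of_fun_def
proof (rule the_equality)
  fix \<omega>
  assume "AE x in lebesgue. rep \<omega> x = f x"
  then have "AE x in lebesgue. rep \<omega> x = rep \<phi> x"
    using assms by eventually_elim simp
  then show "\<omega> = \<phi>"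
    by (rule rep_inject)
qed (rule assms)

lemma rep_of_fun:
  assumes "in_space rep f"
  shows "AE x in lebesgue. rep (of_fun rep f) x = f x"
proof -
  obtain \<phi> where "AE x in lebesgue. rep \<phi> x = f x"
    using assms by (auto simp: in_space_def)
  with of_fun_eqI[OF this] show ?thesis
    by simp
qed

lemma rep_zero: "AE x in lebesgue. rep 0 x = 0"
  using rep_scaleR[of 0 0] by simp

lemma eq_0_if_local_integrals_eq_0:
  assumes "\<And>K. compact K \<Longrightarrow> (LINT x:K|lebesgue. norm (rep \<phi> x)) = 0"
  shows "\<phi> = 0"
proof -
  have "AE x in lebesgue. x \<in> cball 0 (real k) \<longrightarrow> rep \<phi> x = 0" for k
  proof -
    have "integrable lebesgue (\<lambda>x. indicator (cball 0 (real k)) x *\<^sub>R norm (rep \<phi> x))"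
      using set_integrable_norm[OF rep_locally_integrable[OF compact_cball]]
      by (simp add: set_integrable_def)
    from integral_nonneg_eq_0_iff_AE[OF this] assms[OF compact_cball]
    have "AE x in lebesgue. indicator (cball 0 (real k)) x *\<^sub>R norm (rep \<phi> x) = 0"
      by (simp add: set_lebesgue_integral_def)
    then show ?thesis
      by eventually_elim (auto simp: indicator_def)
  qed
  then have "AE x in lebesgue. \<forall>k. x \<in> cball 0 (real k) \<longrightarrow> rep \<phi> x = 0"
    by (intro AE_all_countable[THEN iffD2] allI)
  then have "AE x in lebesgue. rep \<phi> x = 0"
    by eventually_elim (meson mem_cball_0 real_arch_simple)
  then have "AE x in lebesgue. rep \<phi> x = rep 0 x"
    using rep_zero by eventually_elim simp
  then show ?thesis
    by (rule rep_inject)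
qed

text \<open>
  The embedding into the locally integrable functions makes pairings with continuous functions of
  compact support continuous on the space; hence the linear term of the equation is continuous, and
  so integrable, in time.
\<close>
lemma bounded_linear_pairing:
  fixes \<eta> :: "real^'n \<Rightarrow> real"
  assumes "continuous_on UNIV \<eta>" and "compact K" and support: "\<And>x. x \<notin> K \<Longrightarrow> \<eta> x = 0"
  shows "bounded_linear (\<lambda>\<phi>. pairing \<eta> (rep \<phi>))"
proof -
  have "compact (\<eta> ` K)"
    using assms by (intro compact_continuous_image continuous_on_subset[OF assms(1)]) auto
  then obtain B where B: "B > 0" "\<And>x. x \<in> K \<Longrightarrow> \<bar>\<eta> x\<bar> \<le> B"
    by (auto dest!: compact_imp_bounded simp: bounded_pos)
  obtain C where C: "\<And>\<phi>. (LINT x:K|lebesgue. norm (rep \<phi> x)) \<le> C * norm \<phi>"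
    using rep_embedding[OF \<open>compact K\<close>] by blast
  have \<eta>[measurable]: "\<eta> \<in> borel_measurable lebesgue"
    using assms(1) by (intro measurable_completion) (simp add: borel_measurable_continuous_onI)
  have normint: "integrable lebesgue (\<lambda>x. B * norm (indicator K x *\<^sub>R rep \<phi> x))" for \<phi>
    using rep_locally_integrable[OF \<open>compact K\<close>] unfolding set_integrable_def
    by (intro integrable_mult_right integrable_norm)
  have bound: "norm (\<eta> x *\<^sub>R rep \<phi> x) \<le> B * norm (indicator K x *\<^sub>R rep \<phi> x)" for x \<phi>
    using support[of x] B by (cases "x \<in> K") (auto intro: mult_right_mono)
  have int: "integrable lebesgue (\<lambda>x. \<eta> x *\<^sub>R rep \<phi> x)" for \<phi>
  proof (rule Bochner_Integration.integrable_bound[OF normint[of \<phi>]])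
    have [measurable]: "(\<lambda>x. indicator K x *\<^sub>R rep \<phi> x) \<in> borel_measurable lebesgue"
      using rep_locally_integrable[OF \<open>compact K\<close>, of \<phi>] by (simp add: set_integrable_def)
    have "(\<lambda>x. \<eta> x *\<^sub>R rep \<phi> x) = (\<lambda>x. \<eta> x *\<^sub>R (indicator K x *\<^sub>R rep \<phi> x))"
      using support by (auto simp: fun_eq_iff indicator_def)
    also have "\<dots> \<in> borel_measurable lebesgue"
      by measurable
    finally show "(\<lambda>x. \<eta> x *\<^sub>R rep \<phi> x) \<in> borel_measurable lebesgue" .
  qed (use bound in \<open>simp add: order_trans[OF _ abs_ge_self]\<close>)
  show ?thesis
  proof (rule bounded_linear_intro[where K = "B * C"])
    fix \<phi> \<omega> :: 'x and a :: real
    have "AE x in lebesgue. \<eta> x *\<^sub>R rep (\<phi> + \<omega>) x = \<eta> x *\<^sub>R rep \<phi> x + \<eta> x *\<^sub>R rep \<omega> x"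
      using rep_add[of \<phi> \<omega>] by eventually_elim (simp add: scaleR_right_distrib)
    then show "pairing \<eta> (rep (\<phi> + \<omega>)) = pairing \<eta> (rep \<phi>) + pairing \<eta> (rep \<omega>)"
      unfolding pairing_def using int by (simp add: integral_lebesgue_cong_AE)
    have "AE x in lebesgue. \<eta> x *\<^sub>R rep (a *\<^sub>R \<phi>) x = a *\<^sub>R (\<eta> x *\<^sub>R rep \<phi> x)"
      using rep_scaleR[of a \<phi>] by eventually_elim simp
    then show "pairing \<eta> (rep (a *\<^sub>R \<phi>)) = a *\<^sub>R pairing \<eta> (rep \<phi>)"
      unfolding pairing_def by (simp only: integral_lebesgue_cong_AE integral_scaleR_right)
    have "norm (pairing \<eta> (rep \<phi>)) \<le> (LINT x|lebesgue. B * norm (indicator K x *\<^sub>R rep \<phi> x))"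
      unfolding pairing_def
      by (rule order_trans[OF integral_norm_bound integral_mono[OF integrable_norm[OF int] normint bound]])
    also have "\<dots> = B * (LINT x:K|lebesgue. norm (rep \<phi> x))"
      by (simp add: set_lebesgue_integral_def)
    also have "\<dots> \<le> B * (C * norm \<phi>)"
      using C B(1) by (intro mult_left_mono) auto
    finally show "norm (pairing \<eta> (rep \<phi>)) \<le> norm \<phi> * (B * C)"
      by (simp add: mult_ac)
  qed
qed

lemma continuous_on_pairing_test_function:
  assumes "\<theta> \<in> test_functions" "continuous_on I u"
  shows "continuous_on I (\<lambda>t. pairing (multi_diff \<beta> \<theta>) (rep (u t)))"
proof -
  have \<theta>: "smooth \<theta>" "compact (closure {x. \<theta> x \<noteq> 0})"
    using assms(1) by (simp_all add: test_functions_def)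
  have "bounded_linear (\<lambda>\<phi>. pairing (multi_diff \<beta> \<theta>) (rep \<phi>))"
    using continuous_multi_diff[OF \<theta>(1)] \<theta>(2)
    by (rule bounded_linear_pairing) (simp add: multi_diff_def pdiffs_eq_0_outside_support)
  then show ?thesis
    using assms(2) by (rule bounded_linear.continuous_on)
qed

lemma continuous_on_space_op:
  assumes "\<theta> \<in> test_functions" "continuous_on I u"
  shows "continuous_on I (\<lambda>t. space_op P \<epsilon> \<theta> (rep (u t)))"
  unfolding space_op_def
  by (intro continuous_intros bounded_linear.continuous_on[OF matrix_vector_mul_bounded_linear]
      continuous_on_pairing_test_function assms)

end

locale dilation_invariant_function_space = banach_function_space rep
  for rep :: "'x::banach \<Rightarrow> real^'n \<Rightarrow> complex^'q" +
  assumes dilation_invariant: "dilation_invariant rep"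
begin

lemma rep_dilate: "s > 0 \<Longrightarrow> AE x in lebesgue. rep (dilate rep s \<phi>) x = rep \<phi> (s *\<^sub>R x)"
  using dilation_invariant unfolding dilate_def dilation_invariant_def by (intro rep_of_fun) simp

lemma dilate_eqI:
  "(AE x in lebesgue. rep \<omega> x = rep \<phi> (s *\<^sub>R x)) \<Longrightarrow> dilate rep s \<phi> = \<omega>"
  unfolding dilate_def by (rule of_fun_eqI)

lemma dilate_one [simp]: "dilate rep 1 \<phi> = \<phi>"
  by (rule dilate_eqI) simp

lemma dilate_dilate:
  assumes "s > 0" "t > 0"
  shows "dilate rep s (dilate rep t \<phi>) = dilate rep (t * s) \<phi>"
proof -
  have "AE x in lebesgue. rep (dilate rep t \<phi>) (s *\<^sub>R x) = rep \<phi> (t *\<^sub>R s *\<^sub>R x)"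
    using AE_lebesgue_affine[OF _ rep_dilate, of s t \<phi> 0] assms by simp
  then have "AE x in lebesgue. rep (dilate rep (t * s) \<phi>) x = rep (dilate rep t \<phi>) (s *\<^sub>R x)"
    using rep_dilate[of "t * s" \<phi>] assms by (auto elim: eventually_elim2)
  then show ?thesis
    by (rule dilate_eqI)
qed

lemma linear_dilate:
  assumes "s > 0"
  shows "linear (dilate rep s)"
proof (rule linearI)
  fix \<phi> \<omega> :: 'x and a :: real
  have "AE x in lebesgue. rep (\<phi> + \<omega>) (s *\<^sub>R x) = rep \<phi> (s *\<^sub>R x) + rep \<omega> (s *\<^sub>R x)"
    using AE_lebesgue_affine[OF _ rep_add, of s \<phi> \<omega> 0] assms by simp
  with rep_add[of "dilate rep s \<phi>" "dilate rep s \<omega>"] rep_dilate[OF assms, of \<phi>] rep_dilate[OF assms, of \<omega>]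
  have "AE x in lebesgue. rep (dilate rep s \<phi> + dilate rep s \<omega>) x = rep (\<phi> + \<omega>) (s *\<^sub>R x)"
    by eventually_elim simp
  then show "dilate rep s (\<phi> + \<omega>) = dilate rep s \<phi> + dilate rep s \<omega>"
    by (rule dilate_eqI)
  have "AE x in lebesgue. rep (a *\<^sub>R \<phi>) (s *\<^sub>R x) = a *\<^sub>R rep \<phi> (s *\<^sub>R x)"
    using AE_lebesgue_affine[OF _ rep_scaleR, of s a \<phi> 0] assms by simp
  with rep_scaleR[of a "dilate rep s \<phi>"] rep_dilate[OF assms, of \<phi>]
  have "AE x in lebesgue. rep (a *\<^sub>R dilate rep s \<phi>) x = rep (a *\<^sub>R \<phi>) (s *\<^sub>R x)"
    by eventually_elim simp
  then show "dilate rep s (a *\<^sub>R \<phi>) = a *\<^sub>R dilate rep s \<phi>"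
    by (rule dilate_eqI)
qed

lemma local_integral_dilate:
  assumes "s > 0"
  shows "(LINT x:K|lebesgue. norm (rep (dilate rep s \<phi>) x)) =
    (1 / s ^ CARD('n)) * (LINT x:(*\<^sub>R) s ` K|lebesgue. norm (rep \<phi> x))"
proof -
  have "s *\<^sub>R x \<in> (*\<^sub>R) s ` K \<longleftrightarrow> x \<in> K" for x
    using assms by auto
  then have ind: "indicator K x = (indicator ((*\<^sub>R) s ` K) (s *\<^sub>R x) :: real)" for x
    by (simp add: indicator_def)
  have "(LINT x:K|lebesgue. norm (rep (dilate rep s \<phi>) x)) =
      (LINT x|lebesgue. indicator ((*\<^sub>R) s ` K) (0 + s *\<^sub>R x) *\<^sub>R norm (rep \<phi> (0 + s *\<^sub>R x)))"
    unfolding set_lebesgue_integral_def ind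
    by (rule integral_lebesgue_cong_AE) (use rep_dilate[OF assms, of \<phi>] in \<open>auto elim: eventually_mono\<close>)
  also have "\<dots> = (1 / s ^ CARD('n)) * (LINT x:(*\<^sub>R) s ` K|lebesgue. norm (rep \<phi> x))"
    unfolding set_lebesgue_integral_def using assms
    by (subst integral_lebesgue_affine[of s "\<lambda>x. indicator ((*\<^sub>R) s ` K) x *\<^sub>R norm (rep \<phi> x)"]) auto
  finally show ?thesis .
qed

text \<open>
  The graph is closed since convergence in the space implies convergence in \<open>L\<^sup>1\<close> on every compact
  set, and dilations are continuous for the latter.
\<close>
lemma bounded_linear_dilate:
  assumes "s > 0"
  shows "bounded_linear (dilate rep s)"
proof (rule closed_graph_imp_bounded_linear[OF linear_dilate[OF assms]])
  fix X :: "nat \<Rightarrow> 'x" and \<phi> \<omega> :: 'x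
  assume X: "X \<longlonglongrightarrow> \<phi>" and DX: "(\<lambda>n. dilate rep s (X n)) \<longlonglongrightarrow> \<omega>"
  have "\<omega> - dilate rep s \<phi> = 0"
  proof (rule eq_0_if_local_integrals_eq_0)
    fix K :: "(real^'n) set"
    assume K: "compact K"
    then have sK: "compact ((*\<^sub>R) s ` K)"
      by (rule compact_scaling)
    obtain C1 where C1: "\<And>\<phi>. (LINT x:K|lebesgue. norm (rep \<phi> x)) \<le> C1 * norm \<phi>"
      using rep_embedding[OF K] by blast
    obtain C2 where C2: "\<And>\<phi>. (LINT x:(*\<^sub>R) s ` K|lebesgue. norm (rep \<phi> x)) \<le> C2 * norm \<phi>"
      using rep_embedding[OF sK] by blast
    let ?B = "\<lambda>n. C1 * norm (\<omega> - dilate rep s (X n)) + 1 / s ^ CARD('n) * (C2 * norm (X n - \<phi>))"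
    have int: "integrable lebesgue (\<lambda>x. indicator K x *\<^sub>R norm (rep \<nu> x))" for \<nu>
      using set_integrable_norm[OF rep_locally_integrable[OF K]] by (simp add: set_integrable_def)
    have "(LINT x:K|lebesgue. norm (rep (\<omega> - dilate rep s \<phi>) x)) \<le> ?B n" for n
    proof -
      let ?a = "\<omega> - dilate rep s (X n)" and ?b = "dilate rep s (X n - \<phi>)"
      have sum: "\<omega> - dilate rep s \<phi> = ?a + ?b"
        using linear_diff[OF linear_dilate[OF assms], of "X n" \<phi>] by simp
      have "(LINT x:K|lebesgue. norm (rep (?a + ?b) x)) \<le>
          (LINT x|lebesgue. indicator K x *\<^sub>R norm (rep ?a x) + indicator K x *\<^sub>R norm (rep ?b x))"
        unfolding set_lebesgue_integral_def
      proof (rule integral_mono_AE)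
        show "AE x in lebesgue. indicator K x *\<^sub>R norm (rep (?a + ?b) x) \<le>
            indicator K x *\<^sub>R norm (rep ?a x) + indicator K x *\<^sub>R norm (rep ?b x)"
          using rep_add[of ?a ?b] by eventually_elim (auto simp: indicator_def norm_triangle_ineq)
      qed (use int in auto)
      also have "\<dots> = (LINT x:K|lebesgue. norm (rep ?a x)) + (LINT x:K|lebesgue. norm (rep ?b x))"
        unfolding set_lebesgue_integral_def using int by (intro Bochner_Integration.integral_add) auto
      also have "\<dots> \<le> ?B n"
        unfolding local_integral_dilate[OF assms]
        using C1[of ?a] C2[of "X n - \<phi>"] assms by (intro add_mono mult_left_mono) auto
      finally show ?thesis
        by (simp add: sum)
    qed
    moreover have "?B \<longlonglongrightarrow> C1 * norm (\<omega> - \<omega>) + 1 / s ^ CARD('n) * (C2 * norm (\<phi> - \<phi>))"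
      by (intro tendsto_intros X DX)
    ultimately have "(LINT x:K|lebesgue. norm (rep (\<omega> - dilate rep s \<phi>) x)) \<le> 0"
      by (intro tendsto_lowerbound[of ?B 0 sequentially]) auto
    moreover have "(LINT x:K|lebesgue. norm (rep (\<omega> - dilate rep s \<phi>) x)) \<ge> 0"
      unfolding set_lebesgue_integral_def by (intro integral_nonneg_AE) auto
    ultimately show "(LINT x:K|lebesgue. norm (rep (\<omega> - dilate rep s \<phi>) x)) = 0"
      by simp
  qed
  then show "dilate rep s \<phi> = \<omega>"
    by simp
qed

end

section \<open>Rescaling and gluing solutions\<close>

lemma matrix_vector_scaleR: "A *v (a *\<^sub>R v) = a *\<^sub>R (A *v v)" for A :: "complex^'q^'q"
  by (rule linear_scale[OF bounded_linear.linear[OF matrix_vector_mul_bounded_linear]])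

lemma pairing_cong_AE: "(AE x in lebesgue. f x = g x) \<Longrightarrow> pairing \<theta> f = pairing \<theta> g"
  unfolding pairing_def by (intro integral_lebesgue_cong_AE) (auto elim: eventually_mono)

lemma pairing_scaleR: "pairing (\<lambda>x. a *\<^sub>R \<theta> x) f = a *\<^sub>R pairing \<theta> f"
  by (simp add: pairing_def flip: scaleR_scaleR)

text \<open>
  Dilations are moved from the function to the test function, which is where \<open>space_op\<close> has its
  derivatives.
\<close>
lemma pairing_dilate:
  fixes f :: "real^'n \<Rightarrow> complex^'q"
  assumes "s > 0"
  shows "pairing \<theta> (\<lambda>x. c *\<^sub>R f (s *\<^sub>R x)) = (c / s ^ CARD('n)) *\<^sub>R pairing (\<lambda>x. \<theta> ((1 / s) *\<^sub>R x)) f"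
proof -
  have "pairing \<theta> (\<lambda>x. c *\<^sub>R f (s *\<^sub>R x)) = c *\<^sub>R (LINT x|lebesgue. \<theta> ((1 / s) *\<^sub>R (0 + s *\<^sub>R x)) *\<^sub>R f (0 + s *\<^sub>R x))"
    using assms by (simp add: pairing_def mult.commute flip: integral_scaleR_right)
  also have "\<dots> = (c / s ^ CARD('n)) *\<^sub>R pairing (\<lambda>x. \<theta> ((1 / s) *\<^sub>R x)) f"
    using assms unfolding pairing_def
    by (subst integral_lebesgue_affine[of s "\<lambda>x. \<theta> ((1 / s) *\<^sub>R x) *\<^sub>R f x"]) auto
  finally show ?thesis .
qed

lemma space_op_dilate:
  fixes f :: "real^'n \<Rightarrow> complex^'q"
  assumes "s > 0" and "\<theta> \<in> test_functions"
  shows "space_op P (\<epsilon> / s) \<theta> (\<lambda>x. c *\<^sub>R f (s *\<^sub>R x)) =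
    (c / s ^ CARD('n)) *\<^sub>R space_op P \<epsilon> (\<lambda>x. \<theta> ((1 / s) *\<^sub>R x)) f"
proof -
  have "smooth \<theta>"
    using assms(2) by (simp add: test_functions_def)
  from multi_diff_dilate[OF this, of _ "1 / s"] assms(1)
  have "multi_diff \<beta> (\<lambda>x. \<theta> ((1 / s) *\<^sub>R x)) = (\<lambda>x. (1 / s) ^ total_order \<beta> *\<^sub>R multi_diff \<beta> \<theta> ((1 / s) *\<^sub>R x))" for \<beta>
    by blast
  then show ?thesis
    using assms(1)
    by (simp only: space_op_def pairing_dilate pairing_scaleR matrix_vector_scaleR scaleR_sum_right)
      (simp add: power_divide power_minus[of "\<epsilon> / s"] power_minus[of \<epsilon>] mult_ac)
qed

lemma
  fixes f :: "real \<Rightarrow> 'b::{banach, second_countable_topology}"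
  assumes "s > 0"
  shows set_integrable_affine_Icc:
      "set_integrable lebesgue {a..b} (\<lambda>x. f (t + s * x)) \<longleftrightarrow> set_integrable lebesgue {t + s * a..t + s * b} f"
    and set_integral_affine_Icc:
      "(LINT x:{a..b}|lebesgue. f (t + s * x)) = (1 / s) *\<^sub>R (LINT x:{t + s * a..t + s * b}|lebesgue. f x)"
proof -
  have ind: "indicator {a..b} x = (indicator {t + s * a..t + s * b} (t + s * x) :: real)" for x
    using assms by (simp add: indicator_def)
  show "set_integrable lebesgue {a..b} (\<lambda>x. f (t + s * x)) \<longleftrightarrow> set_integrable lebesgue {t + s * a..t + s * b} f"
    unfolding set_integrable_def ind
    using integrable_lebesgue_affine_iff[of s "\<lambda>x. indicator {t + s * a..t + s * b} x *\<^sub>R f x" t] assms by simp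
  show "(LINT x:{a..b}|lebesgue. f (t + s * x)) = (1 / s) *\<^sub>R (LINT x:{t + s * a..t + s * b}|lebesgue. f x)"
    unfolding set_lebesgue_integral_def ind
    using integral_lebesgue_affine[of s "\<lambda>x. indicator {t + s * a..t + s * b} x *\<^sub>R f x" t] assms by simp
qed

context dilation_invariant_function_space
begin

text \<open>
  The substitutions used below are all of this form: time translations (\<open>s = c = 1\<close>), and the passage
  between \<open>\<psi>\<close> and \<open>u\<close> in both directions (\<open>s = \<epsilon>\<close> and \<open>s = 1/\<epsilon>\<close>).  In the weak formulation every
  term picks up the same factor \<open>c / s\<^sup>n\<^sup>+\<^sup>1\<close>: \<open>c / s\<^sup>n\<close> from the pairing in space, and \<open>1/s\<close> from the
  integral in time or, in the boundary term, from \<open>\<epsilon>/s\<close>.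
\<close>
lemma solution_rescale:
  assumes sol: "solution rep P \<epsilon> G I u" and "s > 0"
    and G': "\<And>x z. G' x (c *\<^sub>R z) = c *\<^sub>R G (s *\<^sub>R x) z"
    and J: "\<And>r. r \<in> J \<Longrightarrow> t + s * r \<in> I"
  shows "solution rep P (\<epsilon> / s) G' J (\<lambda>r. c *\<^sub>R dilate rep s (u (t + s * r)))"
    (is "solution rep P _ G' J ?\<psi>")
proof -
  let ?k = "c / s ^ CARD('n)"
  have rep_\<psi>: "AE x in lebesgue. rep (?\<psi> r) x = c *\<^sub>R rep (u (t + s * r)) (s *\<^sub>R x)" for r
    using rep_scaleR[of c "dilate rep s (u (t + s * r))"] rep_dilate[OF \<open>s > 0\<close>, of "u (t + s * r)"]
    by eventually_elim simp
  have G_\<psi>: "AE x in lebesgue. G' x (rep (?\<psi> r) x) =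
      c *\<^sub>R G (s *\<^sub>R x) (rep (u (t + s * r)) (s *\<^sub>R x))" for r
    using rep_\<psi>[of r] by eventually_elim (simp add: G')
  have pair: "pairing \<theta> (rep (?\<psi> r)) = ?k *\<^sub>R pairing (\<lambda>x. \<theta> ((1 / s) *\<^sub>R x)) (rep (u (t + s * r)))" for \<theta> r
    using pairing_cong_AE[OF rep_\<psi>] pairing_dilate[OF \<open>s > 0\<close>] by metis
  have pair_G: "pairing \<theta> (\<lambda>x. G' x (rep (?\<psi> r) x)) =
      ?k *\<^sub>R pairing (\<lambda>x. \<theta> ((1 / s) *\<^sub>R x)) (\<lambda>x. G x (rep (u (t + s * r)) x))" for \<theta> r
    using pairing_cong_AE[OF G_\<psi>]
      pairing_dilate[OF \<open>s > 0\<close>, of \<theta> c "\<lambda>x. G x (rep (u (t + s * r)) x)"] by metis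
  have space: "space_op P (\<epsilon> / s) \<theta> (rep (?\<psi> r)) =
      ?k *\<^sub>R space_op P \<epsilon> (\<lambda>x. \<theta> ((1 / s) *\<^sub>R x)) (rep (u (t + s * r)))" if "\<theta> \<in> test_functions" for \<theta> r
  proof -
    have "space_op P (\<epsilon> / s) \<theta> (rep (?\<psi> r)) =
        space_op P (\<epsilon> / s) \<theta> (\<lambda>x. c *\<^sub>R rep (u (t + s * r)) (s *\<^sub>R x))"
      unfolding space_op_def by (simp only: pairing_cong_AE[OF rep_\<psi>])
    then show ?thesis
      by (simp only: space_op_dilate[OF \<open>s > 0\<close> that])
  qed
  have "continuous_on J ?\<psi>"
  proof -
    have "continuous_on J (\<lambda>r. u (t + s * r))"
    proof -
      have "continuous_on J (u \<circ> (\<lambda>r. t + s * r))"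
      proof (rule continuous_on_compose)
        show "continuous_on J (\<lambda>r. t + s * r)"
          by (intro continuous_intros)
        show "continuous_on ((\<lambda>r. t + s * r) ` J) u"
          using sol J by (auto simp: solution_def intro: continuous_on_subset)
      qed
      then show ?thesis
        by (simp add: o_def)
    qed
    from continuous_on_scaleR[OF continuous_on_const bounded_linear.continuous_on[OF bounded_linear_dilate[OF \<open>s > 0\<close>] this]]
    show ?thesis .
  qed
  moreover have "AE r in lebesgue. r \<in> J \<longrightarrow>
      (\<forall>K. compact K \<longrightarrow> set_integrable lebesgue K (\<lambda>x. G' x (rep (?\<psi> r) x)))"
  proof -
    have "AE r in lebesgue. r \<in> I \<longrightarrow>
        (\<forall>K. compact K \<longrightarrow> set_integrable lebesgue K (\<lambda>x. G x (rep (u r) x)))"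
      using sol by (simp add: solution_def)
    from AE_lebesgue_affine[OF less_imp_neq[OF \<open>s > 0\<close>, symmetric] this, of t]
    have "AE r in lebesgue. t + s *\<^sub>R r \<in> I \<longrightarrow>
        (\<forall>K. compact K \<longrightarrow> set_integrable lebesgue K (\<lambda>x. G x (rep (u (t + s *\<^sub>R r)) x)))" .
    then show ?thesis
    proof (rule eventually_mono, intro impI allI)
      fix r :: real and K :: "(real^'n) set"
      assume *: "t + s *\<^sub>R r \<in> I \<longrightarrow>
        (\<forall>K. compact K \<longrightarrow> set_integrable lebesgue K (\<lambda>x. G x (rep (u (t + s *\<^sub>R r)) x)))"
        and "r \<in> J" "compact K"
      let ?g = "\<lambda>x. indicator ((*\<^sub>R) s ` K) x *\<^sub>R G x (rep (u (t + s * r)) x)"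
      have "integrable lebesgue ?g"
        using * J[OF \<open>r \<in> J\<close>] compact_scaling[OF \<open>compact K\<close>, of s] by (simp add: set_integrable_def)
      from integrable_lebesgue_affine[OF _ this, of s 0] \<open>s > 0\<close>
      have "integrable lebesgue (\<lambda>x. ?g (s *\<^sub>R x))"
        by simp
      then have "integrable lebesgue (\<lambda>x. c *\<^sub>R ?g (s *\<^sub>R x))"
        by (rule integrable_scaleR_right)
      moreover have mem: "s *\<^sub>R x \<in> (*\<^sub>R) s ` K \<longleftrightarrow> x \<in> K" for x
        using \<open>s > 0\<close> by auto
      have "AE x in lebesgue. indicator K x *\<^sub>R G' x (rep (?\<psi> r) x) = c *\<^sub>R ?g (s *\<^sub>R x)"
        using G_\<psi>[of r] by eventually_elim (simp add: indicator_def mem)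
      ultimately show "set_integrable lebesgue K (\<lambda>x. G' x (rep (?\<psi> r) x))"
        unfolding set_integrable_def by (simp add: integrable_lebesgue_cong_AE)
    qed
  qed
  moreover have main: "set_integrable lebesgue {a..b} (\<lambda>r. pairing \<theta> (\<lambda>x. G' x (rep (?\<psi> r) x))) \<and>
      (\<epsilon> / s) *\<^sub>R (pairing \<theta> (rep (?\<psi> b)) - pairing \<theta> (rep (?\<psi> a)))
        + (LINT r:{a..b}|lebesgue. space_op P (\<epsilon> / s) \<theta> (rep (?\<psi> r)))
      = (LINT r:{a..b}|lebesgue. pairing \<theta> (\<lambda>x. G' x (rep (?\<psi> r) x)))"
    if \<theta>: "\<theta> \<in> test_functions" and ab: "a \<in> J" "b \<in> J" "a \<le> b" for \<theta> a b
  proof -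
    let ?\<theta> = "\<lambda>x. \<theta> ((1 / s) *\<^sub>R x)"
    let ?a = "t + s * a" and ?b = "t + s * b"
    let ?R = "\<lambda>r. pairing ?\<theta> (\<lambda>x. G x (rep (u r) x))"
    let ?S = "\<lambda>r. space_op P \<epsilon> ?\<theta> (rep (u r))"
    have "?\<theta> \<in> test_functions"
      using \<theta> \<open>s > 0\<close> by (intro test_functions_dilate) auto
    moreover have "?a \<in> I" "?b \<in> I" "?a \<le> ?b"
      using J ab \<open>s > 0\<close> by auto
    ultimately have int: "set_integrable lebesgue {?a..?b} ?R"
      and eq: "\<epsilon> *\<^sub>R (pairing ?\<theta> (rep (u ?b)) - pairing ?\<theta> (rep (u ?a))) + (LINT r:{?a..?b}|lebesgue. ?S r)
        = (LINT r:{?a..?b}|lebesgue. ?R r)"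
      using sol unfolding solution_def by blast+
    have int': "set_integrable lebesgue {a..b} (\<lambda>r. ?R (t + s * r))"
      using int set_integrable_affine_Icc[OF \<open>s > 0\<close>, of a b ?R t] by blast
    have S_affine: "(LINT r:{a..b}|lebesgue. ?k *\<^sub>R ?S (t + s * r)) = (?k / s) *\<^sub>R (LINT r:{?a..?b}|lebesgue. ?S r)"
      using set_integral_affine_Icc[OF \<open>s > 0\<close>, of a b ?S t] by simp
    have "(\<epsilon> / s) *\<^sub>R (?k *\<^sub>R pairing ?\<theta> (rep (u ?b)) - ?k *\<^sub>R pairing ?\<theta> (rep (u ?a)))
        + (LINT r:{a..b}|lebesgue. ?k *\<^sub>R ?S (t + s * r))
      = (?k / s) *\<^sub>R (\<epsilon> *\<^sub>R (pairing ?\<theta> (rep (u ?b)) - pairing ?\<theta> (rep (u ?a)))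
        + (LINT r:{?a..?b}|lebesgue. ?S r))"
      unfolding S_affine by (simp add: scaleR_right_diff_distrib scaleR_right_distrib mult_ac)
    also have "\<dots> = (LINT r:{a..b}|lebesgue. ?k *\<^sub>R ?R (t + s * r))"
      unfolding eq by (simp add: set_integral_affine_Icc[OF \<open>s > 0\<close>, of a b ?R t])
    finally show ?thesis
      unfolding pair pair_G space[OF \<theta>] using int' by (simp add: set_integrable_scaleR_right)
  qed
  ultimately show ?thesis
    unfolding solution_def
    by (intro conjI ballI impI main) assumption+
qed

corollary solution_translate:
  assumes "solution rep P \<epsilon> G I u" and "\<And>r. r \<in> J \<Longrightarrow> t + r \<in> I"
  shows "solution rep P \<epsilon> G J (\<lambda>r. u (t + r))"
  using solution_rescale[OF assms(1), of 1 G 1 J t] assms(2) by simp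

end

context banach_function_space
begin

lemma solution_subset:
  assumes "solution rep P \<epsilon> G I u" and "J \<subseteq> I"
  shows "solution rep P \<epsilon> G J u"
proof -
  have "AE t in lebesgue. t \<in> I \<longrightarrow> (\<forall>K. compact K \<longrightarrow> set_integrable lebesgue K (\<lambda>x. G x (rep (u t) x)))"
    using assms(1) by (simp add: solution_def)
  then have "AE t in lebesgue. t \<in> J \<longrightarrow> (\<forall>K. compact K \<longrightarrow> set_integrable lebesgue K (\<lambda>x. G x (rep (u t) x)))"
    by (rule eventually_mono) (use assms(2) in blast)
  with assms show ?thesis
    by (auto simp: solution_def subset_iff intro: continuous_on_subset[of I])
qed

text \<open>
  Over an interval that contains the junction \<open>c\<close>, the weak formulation is the sum of those over the
  two pieces, as all its terms are additive in the interval.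
\<close>
lemma solution_glue:
  assumes u: "solution rep P \<epsilon> G {..c} u" and v: "solution rep P \<epsilon> G {c..} v" and "u c = v c"
  shows "solution rep P \<epsilon> G UNIV (\<lambda>t. if t \<le> c then u t else v t)"
proof -
  define w where "w = (\<lambda>t. if t \<le> c then u t else v t)"
  have wu: "w t = u t" if "t \<le> c" for t
    using that by (simp add: w_def)
  have wv: "w t = v t" if "t \<ge> c" for t
    using that \<open>u c = v c\<close> by (cases "t = c") (auto simp: w_def)
  have cont: "continuous_on UNIV w"
  proof -
    have "continuous_on ({..c} \<union> {c..}) w"
      using u v \<open>u c = v c\<close> by (intro continuous_on_If[of "{..c}" "{c..}" u v "\<lambda>t. t \<le> c", folded w_def])
        (auto simp: solution_def intro: antisym)
    moreover have "{..c} \<union> {c..} = UNIV"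
      by auto
    ultimately show ?thesis
      by simp
  qed
  moreover have "AE t in lebesgue. t \<in> UNIV \<longrightarrow>
      (\<forall>K. compact K \<longrightarrow> set_integrable lebesgue K (\<lambda>x. G x (rep (w t) x)))"
  proof -
    have "AE t in lebesgue. t \<in> {..c} \<longrightarrow> (\<forall>K. compact K \<longrightarrow> set_integrable lebesgue K (\<lambda>x. G x (rep (u t) x)))"
      and "AE t in lebesgue. t \<in> {c..} \<longrightarrow> (\<forall>K. compact K \<longrightarrow> set_integrable lebesgue K (\<lambda>x. G x (rep (v t) x)))"
      using u v by (simp_all add: solution_def)
    then show ?thesis
      by eventually_elim (metis atLeast_iff atMost_iff linear wu wv)
  qed
  moreover have main: "set_integrable lebesgue {a..b} (\<lambda>t. pairing \<theta> (\<lambda>x. G x (rep (w t) x))) \<and>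
      \<epsilon> *\<^sub>R (pairing \<theta> (rep (w b)) - pairing \<theta> (rep (w a)))
        + (LINT t:{a..b}|lebesgue. space_op P \<epsilon> \<theta> (rep (w t)))
      = (LINT t:{a..b}|lebesgue. pairing \<theta> (\<lambda>x. G x (rep (w t) x)))" (is "?Q a b")
    if \<theta>: "\<theta> \<in> test_functions" and "a \<le> b" for \<theta> a b
  proof -
    let ?R = "\<lambda>t. pairing \<theta> (\<lambda>x. G x (rep (w t) x))"
    let ?S = "\<lambda>t. space_op P \<epsilon> \<theta> (rep (w t))"
    have left: "?Q a b" if "a \<le> b" "b \<le> c" for a b
    proof -
      have "set_integrable lebesgue {a..b} (\<lambda>t. pairing \<theta> (\<lambda>x. G x (rep (u t) x))) \<and>
          \<epsilon> *\<^sub>R (pairing \<theta> (rep (u b)) - pairing \<theta> (rep (u a)))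
            + (LINT t:{a..b}|lebesgue. space_op P \<epsilon> \<theta> (rep (u t)))
          = (LINT t:{a..b}|lebesgue. pairing \<theta> (\<lambda>x. G x (rep (u t) x)))"
        using u \<theta> that unfolding solution_def by auto
      moreover have "set_integrable lebesgue {a..b} ?R \<longleftrightarrow>
          set_integrable lebesgue {a..b} (\<lambda>t. pairing \<theta> (\<lambda>x. G x (rep (u t) x)))"
        using that by (intro set_integrable_cong) (auto simp: wu)
      moreover have "(LINT t:{a..b}|lebesgue. ?R t) = (LINT t:{a..b}|lebesgue. pairing \<theta> (\<lambda>x. G x (rep (u t) x)))"
        using that by (intro set_lebesgue_integral_cong) (auto simp: wu)
      moreover have "(LINT t:{a..b}|lebesgue. ?S t) = (LINT t:{a..b}|lebesgue. space_op P \<epsilon> \<theta> (rep (u t)))"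
        using that by (intro set_lebesgue_integral_cong) (auto simp: wu)
      ultimately show ?thesis
        using that by (simp add: wu)
    qed
    have right: "?Q a b" if "a \<le> b" "c \<le> a" for a b
    proof -
      have "set_integrable lebesgue {a..b} (\<lambda>t. pairing \<theta> (\<lambda>x. G x (rep (v t) x))) \<and>
          \<epsilon> *\<^sub>R (pairing \<theta> (rep (v b)) - pairing \<theta> (rep (v a)))
            + (LINT t:{a..b}|lebesgue. space_op P \<epsilon> \<theta> (rep (v t)))
          = (LINT t:{a..b}|lebesgue. pairing \<theta> (\<lambda>x. G x (rep (v t) x)))"
        using v \<theta> that unfolding solution_def by auto
      moreover have "set_integrable lebesgue {a..b} ?R \<longleftrightarrow>
          set_integrable lebesgue {a..b} (\<lambda>t. pairing \<theta> (\<lambda>x. G x (rep (v t) x)))"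
        using that by (intro set_integrable_cong) (auto simp: wv)
      moreover have "(LINT t:{a..b}|lebesgue. ?R t) = (LINT t:{a..b}|lebesgue. pairing \<theta> (\<lambda>x. G x (rep (v t) x)))"
        using that by (intro set_lebesgue_integral_cong) (auto simp: wv)
      moreover have "(LINT t:{a..b}|lebesgue. ?S t) = (LINT t:{a..b}|lebesgue. space_op P \<epsilon> \<theta> (rep (v t)))"
        using that by (intro set_lebesgue_integral_cong) (auto simp: wv)
      ultimately show ?thesis
        using that by (simp add: wv)
    qed
    consider "b \<le> c" | "c \<le> a" | "a \<le> c" "c \<le> b"
      by linarith
    then show "?Q a b"
    proof cases
      case 3
      note l = left[OF 3(1) order_refl] and r = right[OF 3(2) order_refl]
      have S: "set_integrable lebesgue {x..y} ?S" for x y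
        using continuous_on_subset[OF continuous_on_space_op[OF \<theta> cont]]
        by (intro absolutely_integrable_continuous_real) auto
      have split: "(LINT t:{a..b}|lebesgue. f t) = (LINT t:{a..c}|lebesgue. f t) + (LINT t:{c..b}|lebesgue. f t)"
        if "set_integrable lebesgue {a..c} f" "set_integrable lebesgue {c..b} f" for f :: "real \<Rightarrow> complex^'q"
      proof -
        have "AE t in lebesgue. t \<noteq> c"
          by (intro AE_completion AE_lborel_singleton)
        then have "AE t in lebesgue. \<not> (t \<in> {a..c} \<and> t \<in> {c..b})"
          by eventually_elim auto
        from set_integral_Un_AE[OF this _ _ that] show ?thesis
          by (simp add: ivl_disj_un_two_touch 3)
      qed
      have "set_integrable lebesgue ({a..c} \<union> {c..b}) ?R"
        using l r by (intro set_integrable_Un) auto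
      then have "set_integrable lebesgue {a..b} ?R"
        by (simp add: ivl_disj_un_two_touch 3)
      moreover have "\<epsilon> *\<^sub>R (pairing \<theta> (rep (w b)) - pairing \<theta> (rep (w a))) + (LINT t:{a..b}|lebesgue. ?S t)
        = (\<epsilon> *\<^sub>R (pairing \<theta> (rep (w c)) - pairing \<theta> (rep (w a))) + (LINT t:{a..c}|lebesgue. ?S t))
        + (\<epsilon> *\<^sub>R (pairing \<theta> (rep (w b)) - pairing \<theta> (rep (w c))) + (LINT t:{c..b}|lebesgue. ?S t))"
        unfolding split[OF S S] by (simp add: algebra_simps)
      moreover have "\<dots> = (LINT t:{a..b}|lebesgue. ?R t)"
        using l r by (simp only: split)
      ultimately show ?thesis
        by simp
    qed (rule left[OF \<open>a \<le> b\<close>], assumption, rule right[OF \<open>a \<le> b\<close>], assumption)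
  qed
  ultimately show ?thesis
    unfolding solution_def w_def[symmetric]
    by (intro conjI ballI impI main) assumption+
qed

end

section \<open>The global flow and the wave operators\<close>

locale scattering_problem = dilation_invariant_function_space rep
  for rep :: "'x::banach \<Rightarrow> real^'n \<Rightarrow> complex^'q" +
  fixes P :: "('n \<Rightarrow>\<^sub>0 nat) \<Rightarrow>\<^sub>0 complex^'q^'q"
    and F :: "real^'n \<Rightarrow> complex^'q \<Rightarrow> complex^'q"
    and U :: "real \<Rightarrow> 'x \<Rightarrow> 'x"
  assumes unitary: "unitary_group rep U"
    and local_wellposed: "assumption2 rep P F U"
    and global_wellposed: "assumption3 rep P F U"
begin

lemma norm_U_diff [simp]: "norm (U t \<phi> - U t \<omega>) = norm (\<phi> - \<omega>)"
  using unitary unfolding unitary_group_def by (metis linear_diff)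

lemma global_solution_unique:
  assumes "solution rep P 1 F UNIV \<psi>" "solution rep P 1 F UNIV \<psi>'" "\<psi> c = \<psi>' c"
  shows "\<psi> = \<psi>'"
proof
  fix t
  let ?R = "norm (\<psi> c) + 1"
  have "\<exists>!\<nu>. solution rep P 1 F UNIV \<nu> \<and> \<nu> 0 = \<psi> c"
    using global_wellposed[unfolded assumption3_def, THEN conjunct1, rule_format, of ?R, THEN conjunct1, rule_format, of "\<psi> c"]
    by (simp add: add_nonneg_pos)
  moreover have "solution rep P 1 F UNIV (\<lambda>r. \<psi> (c + r))" "solution rep P 1 F UNIV (\<lambda>r. \<psi>' (c + r))"
    using assms by (auto intro: solution_translate)
  ultimately have "(\<lambda>r. \<psi> (c + r)) = (\<lambda>r. \<psi>' (c + r))"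
    using assms(3) by (metis add.right_neutral)
  from fun_cong[OF this, of "t - c"] show "\<psi> t = \<psi>' t"
    by simp
qed

lemma global_solution_exists:
  obtains \<psi> where "solution rep P 1 F UNIV \<psi>" "\<psi> c = \<phi>"
proof -
  let ?R = "norm \<phi> + 1"
  have "\<exists>!\<nu>. solution rep P 1 F UNIV \<nu> \<and> \<nu> 0 = \<phi>"
    using global_wellposed[unfolded assumption3_def, THEN conjunct1, rule_format, of ?R, THEN conjunct1, rule_format, of \<phi>]
    by (simp add: add_nonneg_pos)
  then obtain \<nu> where \<nu>: "solution rep P 1 F UNIV \<nu>" "\<nu> 0 = \<phi>"
    by blast
  have "solution rep P 1 F UNIV (\<lambda>r. \<nu> (- c + r))"
    using \<nu>(1) by (rule solution_translate) simp
  with \<nu>(2) show ?thesis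
    by (intro that[of "\<lambda>r. \<nu> (- c + r)"]) auto
qed

text \<open>
  Gluing \<open>v\<close> to the past of \<open>\<psi>\<close> gives a second global solution with the same value at time \<open>c\<close>.
\<close>
lemma forward_solution_eq_global:
  assumes \<psi>: "solution rep P 1 F UNIV \<psi>" and v: "solution rep P 1 F {c..} v" and "v c = \<psi> c" and "t \<ge> c"
  shows "v t = \<psi> t"
proof -
  let ?w = "\<lambda>t. if t \<le> c then \<psi> t else v t"
  have "solution rep P 1 F UNIV ?w"
    using solution_glue[OF solution_subset[OF \<psi>] v] \<open>v c = \<psi> c\<close> by simp
  then have "?w = \<psi>"
    using \<psi> by (rule global_solution_unique[of _ _ c]) simp
  from fun_cong[OF this, of t] assms(3,4) show ?thesis
    by (cases "t = c") auto
qed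

lemma backward_solution_extends:
  assumes u: "solution rep P 1 F {..c} u"
  obtains \<psi> where "solution rep P 1 F UNIV \<psi>" "\<And>t. t \<le> c \<Longrightarrow> \<psi> t = u t"
proof -
  obtain v where v: "solution rep P 1 F UNIV v" "v c = u c"
    by (rule global_solution_exists)
  have "solution rep P 1 F UNIV (\<lambda>t. if t \<le> c then u t else v t)"
    using solution_glue[OF u solution_subset[OF v(1)]] v(2) by simp
  then show ?thesis
    by (rule that) simp
qed

text \<open>
  By translation in time, data at \<open>c\<close> become data at \<open>0\<close>.  The radius \<open>norm (\<psi> c) + 1\<close> leaves room for
  perturbations of size less than \<open>1\<close>.
\<close>
lemma global_solution_stable:
  assumes \<psi>: "solution rep P 1 F UNIV \<psi>" and "\<eta> > 0"
  obtains \<delta> where "\<delta> > 0"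
    "\<And>\<psi>' t. solution rep P 1 F UNIV \<psi>' \<Longrightarrow> norm (\<psi>' c - \<psi> c) < \<delta> \<Longrightarrow> norm (\<psi>' t - \<psi> t) \<le> \<eta>"
proof -
  let ?R = "norm (\<psi> c) + 1"
  have "?R > 0"
    by (simp add: add_nonneg_pos)
  then have "\<exists>\<delta>>0. \<forall>\<nu> \<nu>'. solution rep P 1 F UNIV \<nu> \<and> solution rep P 1 F UNIV \<nu>' \<and>
      \<nu> 0 \<in> ball 0 ?R \<and> \<nu>' 0 \<in> ball 0 ?R \<and> norm (\<nu> 0 - \<nu>' 0) < \<delta> \<longrightarrow>
      (\<forall>t. norm (U (- t) (\<nu> t) - U (- t) (\<nu>' t)) \<le> \<eta>)"
    using global_wellposed[unfolded assumption3_def, THEN conjunct1, rule_format, of ?R] \<open>\<eta> > 0\<close> by simp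
  then obtain \<delta> where \<delta>: "\<delta> > 0" "\<And>\<nu> \<nu>' t. solution rep P 1 F UNIV \<nu> \<Longrightarrow> solution rep P 1 F UNIV \<nu>' \<Longrightarrow>
      \<nu> 0 \<in> ball 0 ?R \<Longrightarrow> \<nu>' 0 \<in> ball 0 ?R \<Longrightarrow> norm (\<nu> 0 - \<nu>' 0) < \<delta> \<Longrightarrow>
      norm (U (- t) (\<nu> t) - U (- t) (\<nu>' t)) \<le> \<eta>"
    by (elim exE conjE) blast
  show ?thesis
  proof (rule that)
    show "min \<delta> 1 > 0"
      using \<delta>(1) by simp
    fix \<psi>' t
    assume \<psi>': "solution rep P 1 F UNIV \<psi>'" and close: "norm (\<psi>' c - \<psi> c) < min \<delta> 1"
    have "norm (U (- (t - c)) (\<psi>' (c + (t - c))) - U (- (t - c)) (\<psi> (c + (t - c)))) \<le> \<eta>"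
    proof (rule \<delta>(2)[of "\<lambda>r. \<psi>' (c + r)" "\<lambda>r. \<psi> (c + r)" "t - c"])
      show "solution rep P 1 F UNIV (\<lambda>r. \<psi>' (c + r))" "solution rep P 1 F UNIV (\<lambda>r. \<psi> (c + r))"
        using \<psi> \<psi>' by (auto intro: solution_translate)
    qed (use close norm_triangle_ineq2[of "\<psi>' c" "\<psi> c"] in auto)
    then show "norm (\<psi>' t - \<psi> t) \<le> \<eta>"
      by simp
  qed
qed

definition incoming :: "'x \<Rightarrow> (real \<Rightarrow> 'x) \<Rightarrow> bool" where
  "incoming \<psi>\<^sub>m \<psi> \<longleftrightarrow> solution rep P 1 F UNIV \<psi> \<and> ((\<lambda>t. U (- t) (\<psi> t)) \<longlongrightarrow> \<psi>\<^sub>m) at_bot"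

text \<open>
  The well-posedness near \<open>-\<infinity>\<close>, restated for global solutions.  From the continuous dependence only
  the value at \<open>-T\<close> is kept: at that time \<open>global_solution_stable\<close> takes over.
\<close>
lemma incoming_solution:
  obtains \<psi> T where "incoming \<psi>\<^sub>m \<psi>" "\<And>\<psi>'. incoming \<psi>\<^sub>m \<psi>' \<Longrightarrow> \<psi>' = \<psi>"
    "\<And>\<eta>. \<eta> > 0 \<Longrightarrow> \<forall>\<^sub>F (\<omega>, t\<^sub>1) in nhds (\<psi>\<^sub>m, -\<infinity>). t\<^sub>1 \<le> ereal (- T) \<longrightarrow>
      (\<forall>\<psi>'. solution rep P 1 F UNIV \<psi>' \<and> data_at U t\<^sub>1 \<omega> \<psi>' \<longrightarrow> norm (\<psi>' (- T) - \<psi> (- T)) < \<eta>)"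
proof -
  obtain T where T: "\<And>t\<^sub>0. t\<^sub>0 \<le> ereal (- T) \<Longrightarrow> \<exists>\<psi>.
      solution rep P 1 F {..-T} \<psi> \<and> data_at U t\<^sub>0 \<psi>\<^sub>m \<psi> \<and>
      (\<forall>\<psi>'. solution rep P 1 F {..-T} \<psi>' \<and> data_at U t\<^sub>0 \<psi>\<^sub>m \<psi>' \<longrightarrow> (\<forall>t\<le>-T. \<psi>' t = \<psi> t)) \<and>
      (\<forall>a. \<forall>\<eta>>0. \<forall>\<^sub>F (\<omega>, t\<^sub>1) in nhds (\<psi>\<^sub>m, t\<^sub>0). t\<^sub>1 \<le> ereal (- T) \<longrightarrow>
        (\<forall>\<psi>'. solution rep P 1 F {..-T} \<psi>' \<and> data_at U t\<^sub>1 \<omega> \<psi>' \<longrightarrow>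
          (\<forall>t\<in>{a..-T}. norm (\<psi>' t - \<psi> t) < \<eta>)))"
    using local_wellposed unfolding assumption2_def by meson
  have "-\<infinity> \<le> ereal (- T)"
    by simp
  from T[OF this] obtain u where u: "solution rep P 1 F {..-T} u" "data_at U (-\<infinity>) \<psi>\<^sub>m u"
    and unique: "\<And>\<psi>' t. solution rep P 1 F {..-T} \<psi>' \<Longrightarrow> data_at U (-\<infinity>) \<psi>\<^sub>m \<psi>' \<Longrightarrow> t \<le> -T \<Longrightarrow> \<psi>' t = u t"
    and stable: "\<And>a \<eta>. \<eta> > 0 \<Longrightarrow> \<forall>\<^sub>F (\<omega>, t\<^sub>1) in nhds (\<psi>\<^sub>m, -\<infinity>). t\<^sub>1 \<le> ereal (- T) \<longrightarrow>
        (\<forall>\<psi>'. solution rep P 1 F {..-T} \<psi>' \<and> data_at U t\<^sub>1 \<omega> \<psi>' \<longrightarrow>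
          (\<forall>t\<in>{a..-T}. norm (\<psi>' t - u t) < \<eta>))"
    by blast
  obtain \<psi> where \<psi>: "solution rep P 1 F UNIV \<psi>" "\<And>t. t \<le> -T \<Longrightarrow> \<psi> t = u t"
    using backward_solution_extends[OF u(1)] by blast
  have "\<forall>\<^sub>F t in at_bot. U (- t) (\<psi> t) = U (- t) (u t)"
    using eventually_le_at_bot[of "-T"] by eventually_elim (simp add: \<psi>(2))
  then have "incoming \<psi>\<^sub>m \<psi>"
    using \<psi>(1) u(2) tendsto_cong by (force simp: incoming_def data_at_def)
  moreover have "\<psi>' = \<psi>" if "incoming \<psi>\<^sub>m \<psi>'" for \<psi>'
  proof -
    have \<psi>': "solution rep P 1 F UNIV \<psi>'" "data_at U (-\<infinity>) \<psi>\<^sub>m \<psi>'"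
      using that by (simp_all add: incoming_def data_at_def)
    have "\<psi>' (-T) = \<psi> (-T)"
      using unique[OF solution_subset[OF \<psi>'(1)] \<psi>'(2)] \<psi>(2) by simp
    with \<psi>'(1) \<psi>(1) show ?thesis
      by (rule global_solution_unique)
  qed
  moreover have "\<forall>\<^sub>F (\<omega>, t\<^sub>1) in nhds (\<psi>\<^sub>m, -\<infinity>). t\<^sub>1 \<le> ereal (- T) \<longrightarrow>
      (\<forall>\<psi>'. solution rep P 1 F UNIV \<psi>' \<and> data_at U t\<^sub>1 \<omega> \<psi>' \<longrightarrow> norm (\<psi>' (- T) - \<psi> (- T)) < \<eta>)"
    if "\<eta> > 0" for \<eta>
    using stable[OF that, of "-T"]
  proof (rule eventually_mono)
    fix y :: "'x \<times> ereal"
    assume *: "case y of (\<omega>, t\<^sub>1) \<Rightarrow> t\<^sub>1 \<le> ereal (- T) \<longrightarrow>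
        (\<forall>\<psi>'. solution rep P 1 F {..-T} \<psi>' \<and> data_at U t\<^sub>1 \<omega> \<psi>' \<longrightarrow>
          (\<forall>t\<in>{-T..-T}. norm (\<psi>' t - u t) < \<eta>))"
    show "case y of (\<omega>, t\<^sub>1) \<Rightarrow> t\<^sub>1 \<le> ereal (- T) \<longrightarrow>
        (\<forall>\<psi>'. solution rep P 1 F UNIV \<psi>' \<and> data_at U t\<^sub>1 \<omega> \<psi>' \<longrightarrow> norm (\<psi>' (- T) - \<psi> (- T)) < \<eta>)"
      using * solution_subset[where I = UNIV and J = "{..-T}"] \<psi>(2)[of "-T"] by (cases y) auto
  qed
  ultimately show ?thesis
    by (rule that)
qed

lemma incoming_unique:
  assumes "incoming \<psi>\<^sub>m \<psi>" "incoming \<psi>\<^sub>m \<psi>'"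
  shows "\<psi>' = \<psi>"
proof -
  obtain \<nu> where "\<And>\<psi>'. incoming \<psi>\<^sub>m \<psi>' \<Longrightarrow> \<psi>' = \<nu>"
    by (rule incoming_solution[of \<psi>\<^sub>m]) blast
  with assms show ?thesis
    by blast
qed

lemma wave_operator_eq:
  assumes "incoming \<psi>\<^sub>m \<psi>"
  shows "wave_operator rep P F U at_bot \<psi>\<^sub>m = \<psi> 0"
  unfolding wave_operator_def
proof (rule the_equality)
  show "\<exists>\<nu>. solution rep P 1 F UNIV \<nu> \<and> ((\<lambda>t. U (- t) (\<nu> t)) \<longlongrightarrow> \<psi>\<^sub>m) at_bot \<and> \<nu> 0 = \<psi> 0"
    using assms by (auto simp: incoming_def)
next
  fix \<phi>
  assume "\<exists>\<nu>. solution rep P 1 F UNIV \<nu> \<and> ((\<lambda>t. U (- t) (\<nu> t)) \<longlongrightarrow> \<psi>\<^sub>m) at_bot \<and> \<nu> 0 = \<phi>"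
  then obtain \<nu> where "incoming \<psi>\<^sub>m \<nu>" "\<nu> 0 = \<phi>"
    by (auto simp: incoming_def)
  then show "\<phi> = \<psi> 0"
    using assms by (blast dest: incoming_unique)
qed

lemma tendsto_scattering_operator:
  assumes "incoming \<psi>\<^sub>m \<psi>"
  shows "((\<lambda>t. U (- t) (\<psi> t)) \<longlongrightarrow> scattering_operator rep P F U \<psi>\<^sub>m) at_top"
proof -
  have "solution rep P 1 F UNIV \<psi>"
    using assms by (simp add: incoming_def)
  then obtain \<psi>\<^sub>p where "((\<lambda>t. norm (U (- t) (\<psi> t) - \<psi>\<^sub>p)) \<longlongrightarrow> 0) at_top"
    using global_wellposed unfolding assumption3_def by blast
  then have lim: "((\<lambda>t. U (- t) (\<psi> t)) \<longlongrightarrow> \<psi>\<^sub>p) at_top"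
    by (simp add: tendsto_norm_zero_iff LIM_zero_iff)
  have "scattering_operator rep P F U \<psi>\<^sub>m = \<psi>\<^sub>p"
    unfolding scattering_operator_def
  proof (rule the_equality)
    show "\<exists>\<nu>. solution rep P 1 F UNIV \<nu> \<and> ((\<lambda>t. U (- t) (\<nu> t)) \<longlongrightarrow> \<psi>\<^sub>m) at_bot \<and>
        ((\<lambda>t. U (- t) (\<nu> t)) \<longlongrightarrow> \<psi>\<^sub>p) at_top"
      using assms lim by (auto simp: incoming_def)
  next
    fix \<omega>
    assume "\<exists>\<nu>. solution rep P 1 F UNIV \<nu> \<and> ((\<lambda>t. U (- t) (\<nu> t)) \<longlongrightarrow> \<psi>\<^sub>m) at_bot \<and>
        ((\<lambda>t. U (- t) (\<nu> t)) \<longlongrightarrow> \<omega>) at_top"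
    then obtain \<nu> where "incoming \<psi>\<^sub>m \<nu>" and \<omega>: "((\<lambda>t. U (- t) (\<nu> t)) \<longlongrightarrow> \<omega>) at_top"
      by (auto simp: incoming_def)
    then have "\<nu> = \<psi>"
      using assms by (blast dest: incoming_unique)
    with \<omega> lim show "\<omega> = \<psi>\<^sub>p"
      by (intro tendsto_unique[OF trivial_limit_at_top_linorder]) auto
  qed
  with lim show ?thesis
    by simp
qed

text \<open>
  Convergence of the data at times tending to \<open>-\<infinity>\<close> propagates to uniform convergence in time, in two
  steps: continuous dependence from \<open>-\<infinity>\<close> to \<open>-T\<close>, then stability of the global flow from \<open>-T\<close> to all
  times.
\<close>
lemma uniform_convergence_to_incoming:
  assumes \<psi>: "incoming \<psi>\<^sub>m \<psi>"
    and \<Psi>: "\<forall>\<^sub>F i in \<F>. solution rep P 1 F UNIV (\<Psi> i)"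
    and s: "filterlim s at_bot \<F>"
    and data: "((\<lambda>i. U (- s i) (\<Psi> i (s i))) \<longlongrightarrow> \<psi>\<^sub>m) \<F>"
    and "\<eta> > 0"
  shows "\<forall>\<^sub>F i in \<F>. \<forall>t. norm (\<Psi> i t - \<psi> t) \<le> \<eta>"
proof -
  obtain T where T: "\<And>\<eta>. \<eta> > 0 \<Longrightarrow> \<forall>\<^sub>F (\<omega>, t\<^sub>1) in nhds (\<psi>\<^sub>m, -\<infinity>). t\<^sub>1 \<le> ereal (- T) \<longrightarrow>
      (\<forall>\<psi>'. solution rep P 1 F UNIV \<psi>' \<and> data_at U t\<^sub>1 \<omega> \<psi>' \<longrightarrow> norm (\<psi>' (- T) - \<psi> (- T)) < \<eta>)"
  proof -
    obtain \<nu> T where \<nu>: "incoming \<psi>\<^sub>m \<nu>" "\<And>\<psi>'. incoming \<psi>\<^sub>m \<psi>' \<Longrightarrow> \<psi>' = \<nu>"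
      and T: "\<And>\<eta>. \<eta> > 0 \<Longrightarrow> \<forall>\<^sub>F (\<omega>, t\<^sub>1) in nhds (\<psi>\<^sub>m, -\<infinity>). t\<^sub>1 \<le> ereal (- T) \<longrightarrow>
      (\<forall>\<psi>'. solution rep P 1 F UNIV \<psi>' \<and> data_at U t\<^sub>1 \<omega> \<psi>' \<longrightarrow> norm (\<psi>' (- T) - \<nu> (- T)) < \<eta>)"
      by (rule incoming_solution[of \<psi>\<^sub>m]) blast
    show ?thesis
      using T unfolding \<nu>(2)[OF \<psi>, symmetric] by (rule that)
  qed
  have "solution rep P 1 F UNIV \<psi>"
    using \<psi> by (simp add: incoming_def)
  then obtain \<delta> where \<delta>: "\<delta> > 0"
    "\<And>\<psi>' t. solution rep P 1 F UNIV \<psi>' \<Longrightarrow> norm (\<psi>' (-T) - \<psi> (-T)) < \<delta> \<Longrightarrow> norm (\<psi>' t - \<psi> t) \<le> \<eta>"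
    using \<open>\<eta> > 0\<close> by (rule global_solution_stable[where c = "-T"]) blast
  have "((\<lambda>i. ereal (s i)) \<longlongrightarrow> -\<infinity>) \<F>"
    using s by (simp add: tendsto_MInfty filterlim_at_bot_dense)
  with data have "((\<lambda>i. (U (- s i) (\<Psi> i (s i)), ereal (s i))) \<longlongrightarrow> (\<psi>\<^sub>m, -\<infinity>)) \<F>"
    by (rule tendsto_Pair)
  from eventually_compose_filterlim[OF T[OF \<delta>(1)] this]
  have "\<forall>\<^sub>F i in \<F>. s i \<le> - T \<longrightarrow> (\<forall>\<psi>'. solution rep P 1 F UNIV \<psi>' \<and>
      data_at U (ereal (s i)) (U (- s i) (\<Psi> i (s i))) \<psi>' \<longrightarrow> norm (\<psi>' (- T) - \<psi> (- T)) < \<delta>)"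
    by simp
  moreover have "\<forall>\<^sub>F i in \<F>. s i \<le> - T"
    using s by (simp add: filterlim_at_bot)
  ultimately show ?thesis
    using \<Psi>
  proof eventually_elim
    case (elim i)
    then have "norm (\<Psi> i (- T) - \<psi> (- T)) < \<delta>"
      by (simp add: data_at_def)
    with \<delta>(2) elim(3) show ?case
      by blast
  qed
qed

end

section \<open>Profiles of semiclassical solutions\<close>

lemma SUP_ereal_tendsto_0:
  fixes f :: "'i \<Rightarrow> 'a \<Rightarrow> real"
  assumes "S \<noteq> {}" and nonneg: "\<And>i t. 0 \<le> f i t"
    and unif: "\<And>\<eta>. \<eta> > 0 \<Longrightarrow> \<forall>\<^sub>F i in \<F>. \<forall>t\<in>S. f i t \<le> \<eta>"
  shows "((\<lambda>i. SUP t\<in>S. ereal (f i t)) \<longlongrightarrow> 0) \<F>"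
proof (rule order_tendstoI)
  fix a :: ereal
  assume "a < 0"
  have "0 \<le> (SUP t\<in>S. ereal (f i t))" for i
    using \<open>S \<noteq> {}\<close> nonneg by (auto intro: SUP_upper2)
  with \<open>a < 0\<close> show "\<forall>\<^sub>F i in \<F>. a < (SUP t\<in>S. ereal (f i t))"
    by (auto intro: always_eventually less_le_trans)
next
  fix a :: ereal
  assume "0 < a"
  then obtain \<eta> where \<eta>: "0 < ereal \<eta>" "ereal \<eta> < a"
    using ereal_dense2 by blast
  from unif[of \<eta>] \<eta>(1) have "\<forall>\<^sub>F i in \<F>. \<forall>t\<in>S. f i t \<le> \<eta>"
    by simp
  then show "\<forall>\<^sub>F i in \<F>. (SUP t\<in>S. ereal (f i t)) < a"
  proof eventually_elim
    case (elim i)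
    then have "(SUP t\<in>S. ereal (f i t)) \<le> ereal \<eta>"
      by (intro SUP_least) simp
    with \<eta>(2) show ?case
      by simp
  qed
qed

context dilation_invariant_function_space
begin

lemma norm_eps_dilate:
  assumes "\<epsilon> > 0"
  shows "norm_eps rep \<alpha> \<epsilon> (dilate rep (1 / \<epsilon>) \<phi>) = norm (\<epsilon> powr \<alpha> *\<^sub>R \<phi>)"
  using assms by (simp add: norm_eps_def dilate_dilate)

lemma semiclassical_solution_of_profile:
  assumes "\<epsilon> > 0" and "homogeneous p F" and \<psi>: "solution rep P 1 F {- 1 / \<epsilon>..} \<psi>"
    and data: "\<psi> (- 1 / \<epsilon>) = \<epsilon> powr \<alpha> *\<^sub>R A (- 1 / \<epsilon>) + \<epsilon> powr \<alpha> *\<^sub>R dilate rep \<epsilon> r"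
  shows "semiclassical_solution rep P F p \<alpha> A r \<epsilon>
    (\<lambda>t. \<epsilon> powr (- \<alpha>) *\<^sub>R dilate rep (1 / \<epsilon>) (\<psi> ((t - 1) / \<epsilon>)))"
proof -
  have "solution rep P (1 / (1 / \<epsilon>)) (\<lambda>x z. (\<epsilon> powr (\<alpha> * (p - 1))) *\<^sub>R F ((1 / \<epsilon>) *\<^sub>R x) z) {0..}
      (\<lambda>t. \<epsilon> powr (- \<alpha>) *\<^sub>R dilate rep (1 / \<epsilon>) (\<psi> (- 1 / \<epsilon> + (1 / \<epsilon>) * t)))"
  proof (rule solution_rescale[OF \<psi>])
    fix x z
    show "(\<epsilon> powr (\<alpha> * (p - 1))) *\<^sub>R F ((1 / \<epsilon>) *\<^sub>R x) (\<epsilon> powr (- \<alpha>) *\<^sub>R z) =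
        \<epsilon> powr (- \<alpha>) *\<^sub>R F ((1 / \<epsilon>) *\<^sub>R x) z"
      using assms(1,2) by (simp add: homogeneous_def powr_powr powr_add[symmetric] algebra_simps)
  qed (use \<open>\<epsilon> > 0\<close> in auto)
  moreover have "- 1 / \<epsilon> + (1 / \<epsilon>) * t = (t - 1) / \<epsilon>" for t
    using \<open>\<epsilon> > 0\<close> by (simp add: field_simps)
  moreover have "\<epsilon> powr (- \<alpha>) *\<^sub>R dilate rep (1 / \<epsilon>) (\<psi> ((0 - 1) / \<epsilon>)) = dilate rep (1 / \<epsilon>) (A (- 1 / \<epsilon>)) + r"
  proof -
    interpret D: bounded_linear "dilate rep (1 / \<epsilon>)"
      using \<open>\<epsilon> > 0\<close> by (simp add: bounded_linear_dilate)
    show ?thesis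
      using \<open>\<epsilon> > 0\<close> data
      by (simp add: D.add D.scaleR dilate_dilate scaleR_right_distrib powr_add[symmetric])
  qed
  ultimately show ?thesis
    by (simp add: semiclassical_solution_def)
qed

lemma profile_of_semiclassical_solution:
  assumes "\<epsilon> > 0" and "homogeneous p F" and v: "semiclassical_solution rep P F p \<alpha> A r \<epsilon> v"
  defines "\<psi> \<equiv> \<lambda>s. \<epsilon> powr \<alpha> *\<^sub>R dilate rep \<epsilon> (v (1 + \<epsilon> * s))"
  shows "solution rep P 1 F {- 1 / \<epsilon>..} \<psi>"
    and "\<psi> (- 1 / \<epsilon>) = \<epsilon> powr \<alpha> *\<^sub>R A (- 1 / \<epsilon>) + \<epsilon> powr \<alpha> *\<^sub>R dilate rep \<epsilon> r"
proof -
  have v': "solution rep P \<epsilon> (\<lambda>x z. (\<epsilon> powr (\<alpha> * (p - 1))) *\<^sub>R F ((1 / \<epsilon>) *\<^sub>R x) z) {0..} v"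
    and v0: "v 0 = dilate rep (1 / \<epsilon>) (A (- 1 / \<epsilon>)) + r"
    using v by (simp_all add: semiclassical_solution_def)
  have "solution rep P (\<epsilon> / \<epsilon>) F {- 1 / \<epsilon>..} \<psi>"
    unfolding \<psi>_def
  proof (rule solution_rescale[OF v'])
    fix x z
    have "F x (\<epsilon> powr \<alpha> *\<^sub>R z) = (\<epsilon> powr \<alpha>) powr p *\<^sub>R F x z"
      using assms(1,2) by (simp add: homogeneous_def)
    also have "(\<epsilon> powr \<alpha>) powr p = \<epsilon> powr \<alpha> * \<epsilon> powr (\<alpha> * (p - 1))"
      by (simp add: powr_powr powr_add[symmetric] algebra_simps)
    finally show "F x (\<epsilon> powr \<alpha> *\<^sub>R z) =
        \<epsilon> powr \<alpha> *\<^sub>R (\<epsilon> powr (\<alpha> * (p - 1))) *\<^sub>R F ((1 / \<epsilon>) *\<^sub>R \<epsilon> *\<^sub>R x) z"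
      using \<open>\<epsilon> > 0\<close> by simp
  next
    fix s
    assume "s \<in> {- 1 / \<epsilon>..}"
    then show "1 + \<epsilon> * s \<in> {0..}"
      using \<open>\<epsilon> > 0\<close> by (simp add: field_simps)
  qed (rule \<open>\<epsilon> > 0\<close>)
  then show "solution rep P 1 F {- 1 / \<epsilon>..} \<psi>"
    using \<open>\<epsilon> > 0\<close> by simp
  interpret D: bounded_linear "dilate rep \<epsilon>"
    using \<open>\<epsilon> > 0\<close> by (simp add: bounded_linear_dilate)
  show "\<psi> (- 1 / \<epsilon>) = \<epsilon> powr \<alpha> *\<^sub>R A (- 1 / \<epsilon>) + \<epsilon> powr \<alpha> *\<^sub>R dilate rep \<epsilon> r"
    using \<open>\<epsilon> > 0\<close> by (simp add: \<psi>_def v0 D.add dilate_dilate scaleR_right_distrib)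
qed

end

context scattering_problem
begin

lemma semiclassical_solution_eq:
  assumes "\<epsilon> > 0" and "homogeneous p F"
    and \<psi>: "solution rep P 1 F UNIV \<psi>"
    and data: "\<psi> (- 1 / \<epsilon>) = \<epsilon> powr \<alpha> *\<^sub>R A (- 1 / \<epsilon>) + \<epsilon> powr \<alpha> *\<^sub>R dilate rep \<epsilon> r"
    and v: "semiclassical_solution rep P F p \<alpha> A r \<epsilon> v" and "t \<ge> 0"
  shows "v t = \<epsilon> powr (- \<alpha>) *\<^sub>R dilate rep (1 / \<epsilon>) (\<psi> ((t - 1) / \<epsilon>))"
proof -
  let ?s = "(t - 1) / \<epsilon>"
  have "\<epsilon> powr \<alpha> *\<^sub>R dilate rep \<epsilon> (v (1 + \<epsilon> * ?s)) = \<psi> ?s"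
  proof (rule forward_solution_eq_global[OF \<psi> profile_of_semiclassical_solution(1)[OF assms(1,2) v]])
    show "?s \<ge> - 1 / \<epsilon>"
      using \<open>\<epsilon> > 0\<close> \<open>t \<ge> 0\<close> by (intro divide_right_mono) auto
  qed (use profile_of_semiclassical_solution(2)[OF assms(1,2) v] data in simp)
  then have profile: "\<psi> ?s = \<epsilon> powr \<alpha> *\<^sub>R dilate rep \<epsilon> (v t)"
    using \<open>\<epsilon> > 0\<close> by simp
  interpret D: bounded_linear "dilate rep (1 / \<epsilon>)"
    using \<open>\<epsilon> > 0\<close> by (simp add: bounded_linear_dilate)
  show ?thesis
    using \<open>\<epsilon> > 0\<close> by (simp add: profile D.scaleR dilate_dilate powr_add[symmetric])
qed

lemma norm_eps_profile_diff:
  assumes "\<epsilon> > 0" and "u = \<epsilon> powr (- \<alpha>) *\<^sub>R dilate rep (1 / \<epsilon>) \<phi>"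
  shows "norm_eps rep \<alpha> \<epsilon> (u - c *\<^sub>R dilate rep (1 / \<epsilon>) \<omega>) = norm (\<phi> - (\<epsilon> powr \<alpha> * c) *\<^sub>R \<omega>)"
proof -
  interpret D: bounded_linear "dilate rep (1 / \<epsilon>)"
    using \<open>\<epsilon> > 0\<close> by (simp add: bounded_linear_dilate)
  have "u - c *\<^sub>R dilate rep (1 / \<epsilon>) \<omega> = dilate rep (1 / \<epsilon>) (\<epsilon> powr (- \<alpha>) *\<^sub>R \<phi> - c *\<^sub>R \<omega>)"
    using assms(2) by (simp add: D.diff D.scaleR)
  moreover have "\<epsilon> powr \<alpha> *\<^sub>R (\<epsilon> powr (- \<alpha>) *\<^sub>R \<phi> - c *\<^sub>R \<omega>) = \<phi> - (\<epsilon> powr \<alpha> * c) *\<^sub>R \<omega>"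
    using \<open>\<epsilon> > 0\<close> by (simp add: scaleR_right_diff_distrib powr_add[symmetric])
  ultimately show ?thesis
    using norm_eps_dilate[OF \<open>\<epsilon> > 0\<close>] by metis
qed

text \<open>
  Since \<open>U\<close> is isometric, comparing with the profile \<open>B\<close> is the same after the free evolution has been
  undone, where both functions have the limit \<open>\<phi>\<close>.
\<close>
lemma asymptotics_transfer:
  assumes \<psi>: "((\<lambda>t. U (- t) (\<psi> t)) \<longlongrightarrow> \<phi>) \<F>"
    and B: "((\<lambda>t. norm (\<phi> - U (- t) (B t))) \<longlongrightarrow> 0) \<F>"
  shows "((\<lambda>t. norm (\<psi> t - B t)) \<longlongrightarrow> 0) \<F>"
proof (rule Lim_null_comparison)
  show "((\<lambda>t. norm (U (- t) (\<psi> t) - \<phi>) + norm (\<phi> - U (- t) (B t))) \<longlongrightarrow> 0) \<F>"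
    using tendsto_add[OF tendsto_norm[OF LIM_zero[OF \<psi>]] B] by simp
  have "norm (\<psi> t - B t) \<le> norm (U (- t) (\<psi> t) - \<phi>) + norm (\<phi> - U (- t) (B t))" for t
    using norm_triangle_ineq[of "U (- t) (\<psi> t) - \<phi>" "\<phi> - U (- t) (B t)"] norm_U_diff[of "- t"] by simp
  then show "\<forall>\<^sub>F t in \<F>. norm (norm (\<psi> t - B t)) \<le> norm (U (- t) (\<psi> t) - \<phi>) + norm (\<phi> - U (- t) (B t))"
    by simp
qed

text \<open>
  The two cases, before and after the focusing time \<open>1\<close>, with \<open>\<F>\<close> being \<open>at_bot\<close> or \<open>at_top\<close>.  With
  \<open>s = (t - 1)/\<epsilon>\<close>, the factor \<open>|t - 1|\<^sup>-\<^sup>\<alpha>\<close> of the approximation becomes \<open>|s|\<^sup>-\<^sup>\<alpha>\<close>, since the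
  normalisation contributes \<open>\<epsilon>\<^sup>\<alpha>\<close>.
\<close>
lemma sup_norm_eps_tendsto_0:
  assumes u: "\<forall>\<^sub>F \<epsilon> in at_right 0. \<forall>t\<in>S. u \<epsilon> t = \<epsilon> powr (- \<alpha>) *\<^sub>R dilate rep (1 / \<epsilon>) (\<Psi> \<epsilon> ((t - 1) / \<epsilon>))"
    and \<Psi>: "\<And>\<eta>. \<eta> > 0 \<Longrightarrow> \<forall>\<^sub>F \<epsilon> in at_right 0. \<forall>t. norm (\<Psi> \<epsilon> t - \<psi> t) \<le> \<eta>"
    and B: "((\<lambda>s. norm (\<psi> s - \<bar>s\<bar> powr (- \<alpha>) *\<^sub>R B s)) \<longlongrightarrow> 0) \<F>"
    and S: "\<And>Q. eventually Q \<F> \<Longrightarrow> \<forall>\<^sub>F \<epsilon> in at_right 0. \<forall>t\<in>S. Q ((t - 1) / \<epsilon>)"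
    and "S \<noteq> {}" "1 \<notin> S"
  shows "((\<lambda>\<epsilon>. SUP t\<in>S. ereal (norm_eps rep \<alpha> \<epsilon>
      (u \<epsilon> t - (1 / \<bar>t - 1\<bar> powr \<alpha>) *\<^sub>R dilate rep (1 / \<epsilon>) (B ((t - 1) / \<epsilon>))))) \<longlongrightarrow> 0) (at_right 0)"
proof (rule SUP_ereal_tendsto_0)
  fix \<eta> :: real
  assume "\<eta> > 0"
  then have "\<forall>\<^sub>F s in \<F>. norm (\<psi> s - \<bar>s\<bar> powr (- \<alpha>) *\<^sub>R B s) < \<eta> / 2"
    using order_tendstoD(2)[OF B, of "\<eta> / 2"] by simp
  from S[OF this] \<Psi>[OF half_gt_zero[OF \<open>\<eta> > 0\<close>]] u eventually_at_right_less[of 0]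
  show "\<forall>\<^sub>F \<epsilon> in at_right 0. \<forall>t\<in>S. norm_eps rep \<alpha> \<epsilon>
      (u \<epsilon> t - (1 / \<bar>t - 1\<bar> powr \<alpha>) *\<^sub>R dilate rep (1 / \<epsilon>) (B ((t - 1) / \<epsilon>))) \<le> \<eta>"
  proof eventually_elim
    case (elim \<epsilon>)
    show ?case
    proof
      fix t
      assume "t \<in> S"
      let ?s = "(t - 1) / \<epsilon>"
      have "norm_eps rep \<alpha> \<epsilon> (u \<epsilon> t - (1 / \<bar>t - 1\<bar> powr \<alpha>) *\<^sub>R dilate rep (1 / \<epsilon>) (B ?s)) =
          norm (\<Psi> \<epsilon> ?s - (\<epsilon> powr \<alpha> * (1 / \<bar>t - 1\<bar> powr \<alpha>)) *\<^sub>R B ?s)"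
        using elim(3,4) \<open>t \<in> S\<close> by (intro norm_eps_profile_diff) auto
      also have "\<epsilon> powr \<alpha> * (1 / \<bar>t - 1\<bar> powr \<alpha>) = \<bar>?s\<bar> powr (- \<alpha>)"
        using elim(4) by (simp add: powr_divide powr_minus_divide abs_divide)
      also have "norm (\<Psi> \<epsilon> ?s - \<bar>?s\<bar> powr (- \<alpha>) *\<^sub>R B ?s) \<le>
          norm (\<Psi> \<epsilon> ?s - \<psi> ?s) + norm (\<psi> ?s - \<bar>?s\<bar> powr (- \<alpha>) *\<^sub>R B ?s)"
        using norm_triangle_ineq[of "\<Psi> \<epsilon> ?s - \<psi> ?s" "\<psi> ?s - \<bar>?s\<bar> powr (- \<alpha>) *\<^sub>R B ?s"] by simp
      also have "\<dots> \<le> \<eta> / 2 + \<eta> / 2"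
        using elim(1,2) \<open>t \<in> S\<close> by (intro add_mono) (auto intro: less_imp_le)
      finally show "norm_eps rep \<alpha> \<epsilon> (u \<epsilon> t - (1 / \<bar>t - 1\<bar> powr \<alpha>) *\<^sub>R dilate rep (1 / \<epsilon>) (B ?s)) \<le> \<eta>"
        by simp
    qed
  qed
qed (use \<open>S \<noteq> {}\<close> in \<open>auto simp: norm_eps_def\<close>)

end

lemma eventually_rescaled_times_at_bot:
  assumes "eventually Q at_bot" and "\<tau> < (1::real)"
  shows "\<forall>\<^sub>F \<epsilon> in at_right 0. \<forall>t\<in>{0..\<tau>}. Q ((t - 1) / \<epsilon>)"
proof -
  obtain N where N: "\<And>s. s \<le> N \<Longrightarrow> Q s"
    using assms(1) by (auto simp: eventually_at_bot_linorder)
  have "filterlim (\<lambda>\<epsilon>. (\<tau> - 1) / \<epsilon>) at_bot (at_right 0)"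
    using filterlim_tendsto_neg_mult_at_bot[OF tendsto_const _ filterlim_inverse_at_top_right, of "\<tau> - 1"] \<open>\<tau> < 1\<close>
    by (simp add: divide_inverse)
  then have "\<forall>\<^sub>F \<epsilon> in at_right 0. (\<tau> - 1) / \<epsilon> \<le> N"
    by (simp add: filterlim_at_bot)
  with eventually_at_right_less[of 0] show ?thesis
  proof eventually_elim
    case (elim \<epsilon>)
    then show ?case
      by (auto intro!: N order_trans[OF divide_right_mono elim(2)])
  qed
qed

lemma eventually_rescaled_times_at_top:
  assumes "eventually Q at_top" and "\<tau> > (1::real)"
  shows "\<forall>\<^sub>F \<epsilon> in at_right 0. \<forall>t\<in>{\<tau>..}. Q ((t - 1) / \<epsilon>)"
proof -
  obtain N where N: "\<And>s. s \<ge> N \<Longrightarrow> Q s"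
    using assms(1) by (auto simp: eventually_at_top_linorder)
  have "filterlim (\<lambda>\<epsilon>. (\<tau> - 1) / \<epsilon>) at_top (at_right 0)"
    using filterlim_tendsto_pos_mult_at_top[OF tendsto_const _ filterlim_inverse_at_top_right, of "\<tau> - 1"] \<open>\<tau> > 1\<close>
    by (simp add: divide_inverse)
  then have "\<forall>\<^sub>F \<epsilon> in at_right 0. N \<le> (\<tau> - 1) / \<epsilon>"
    by (simp add: filterlim_at_top)
  with eventually_at_right_less[of 0] show ?thesis
  proof eventually_elim
    case (elim \<epsilon>)
    then show ?case
      by (auto intro!: N order_trans[OF elim(2) divide_right_mono])
  qed
qed

section \<open>Focusing at a point\<close>

theorem theorem2p5:
  fixes rep :: "'x::banach \<Rightarrow> real^'n \<Rightarrow> complex^'q"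
    and P :: "('n \<Rightarrow>\<^sub>0 nat) \<Rightarrow>\<^sub>0 complex^'q^'q"
    and F :: "real^'n \<Rightarrow> complex^'q \<Rightarrow> complex^'q"
    and U :: "real \<Rightarrow> 'x \<Rightarrow> 'x"
    and A\<^sub>m A\<^sub>p :: "'x \<Rightarrow> real \<Rightarrow> 'x"
    and p \<alpha> :: real
    and \<psi>\<^sub>m :: 'x
    and r :: "real \<Rightarrow> 'x"
  assumes "banach_function_space rep"
    and "dilation_invariant rep"
    and "p > 1" and "homogeneous p F"
    and "assumption1 rep P U \<alpha> A\<^sub>m A\<^sub>p"
    and "assumption2 rep P F U"
    and "assumption3 rep P F U"
    and "((\<lambda>\<epsilon>. norm_eps rep \<alpha> \<epsilon> (r \<epsilon>)) \<longlongrightarrow> 0) (at_right 0)"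
  shows "\<exists>\<epsilon>\<^sub>0. 0 < \<epsilon>\<^sub>0 \<and> \<epsilon>\<^sub>0 \<le> 1 \<and>
    (\<forall>\<epsilon>\<in>{0<..<\<epsilon>\<^sub>0}. \<exists>u. semiclassical_solution rep P F p \<alpha> (A\<^sub>m \<psi>\<^sub>m) (r \<epsilon>) \<epsilon> u \<and>
      (\<forall>v. semiclassical_solution rep P F p \<alpha> (A\<^sub>m \<psi>\<^sub>m) (r \<epsilon>) \<epsilon> v \<longrightarrow> (\<forall>t\<ge>0. v t = u t))) \<and>
    (\<forall>u. (\<forall>\<epsilon>\<in>{0<..<\<epsilon>\<^sub>0}. semiclassical_solution rep P F p \<alpha> (A\<^sub>m \<psi>\<^sub>m) (r \<epsilon>) \<epsilon> (u \<epsilon>)) \<longrightarrow>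
      (\<forall>\<tau>. 0 < \<tau> \<and> \<tau> < 1 \<longrightarrow>
        ((\<lambda>\<epsilon>. SUP t\<in>{0..\<tau>}. ereal (norm_eps rep \<alpha> \<epsilon>
            (u \<epsilon> t - (1 / (1 - t) powr \<alpha>) *\<^sub>R dilate rep (1 / \<epsilon>) (A\<^sub>m \<psi>\<^sub>m ((t - 1) / \<epsilon>)))))
          \<longlongrightarrow> 0) (at_right 0)) \<and>
      (\<forall>\<tau>>1.
        ((\<lambda>\<epsilon>. SUP t\<in>{\<tau>..}. ereal (norm_eps rep \<alpha> \<epsilon>
            (u \<epsilon> t - (1 / (t - 1) powr \<alpha>) *\<^sub>R dilate rep (1 / \<epsilon>)
              (A\<^sub>p (scattering_operator rep P F U \<psi>\<^sub>m) ((t - 1) / \<epsilon>)))))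
          \<longlongrightarrow> 0) (at_right 0)) \<and>
      ((\<lambda>\<epsilon>. norm_eps rep \<alpha> \<epsilon>
          (u \<epsilon> 1 - (1 / \<epsilon> powr \<alpha>) *\<^sub>R dilate rep (1 / \<epsilon>) (wave_operator rep P F U at_bot \<psi>\<^sub>m)))
        \<longlongrightarrow> 0) (at_right 0))"
proof -
  have unitary: "unitary_group rep U"
    and A_minus: "\<And>\<phi>. ((\<lambda>t. norm (\<phi> - U (- t) ((\<bar>t\<bar> powr (- \<alpha>)) *\<^sub>R A\<^sub>m \<phi> t))) \<longlongrightarrow> 0) at_bot"
    and A_plus: "\<And>\<phi>. ((\<lambda>t. norm (\<phi> - U (- t) ((\<bar>t\<bar> powr (- \<alpha>)) *\<^sub>R A\<^sub>p \<phi> t))) \<longlongrightarrow> 0) at_top"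
    using assms(5) by (simp_all add: assumption1_def)
  interpret banach_function_space rep
    by fact
  interpret scattering_problem rep P F U
    using assms unitary by unfold_locales
  note pos = eventually_at_right_less[of "0::real"]
  \<comment> \<open>The initial value of the semiclassical problem, in the variables of the profile.\<close>
  define D where "D \<epsilon> = \<epsilon> powr \<alpha> *\<^sub>R A\<^sub>m \<psi>\<^sub>m (- 1 / \<epsilon>) + \<epsilon> powr \<alpha> *\<^sub>R dilate rep \<epsilon> (r \<epsilon>)" for \<epsilon>
  have "\<exists>\<psi>. solution rep P 1 F UNIV \<psi> \<and> \<psi> (- 1 / \<epsilon>) = D \<epsilon>" for \<epsilon>
    using global_solution_exists by metis
  then obtain \<Psi> where \<Psi>: "\<And>\<epsilon>. solution rep P 1 F UNIV (\<Psi> \<epsilon>)" "\<And>\<epsilon>. \<Psi> \<epsilon> (- 1 / \<epsilon>) = D \<epsilon>"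
    by metis
  obtain \<psi> where \<psi>: "incoming \<psi>\<^sub>m \<psi>"
    by (rule incoming_solution)
  have times: "filterlim (\<lambda>\<epsilon>. - 1 / \<epsilon>) at_bot (at_right (0::real))"
    using filterlim_tendsto_neg_mult_at_bot[OF tendsto_const _ filterlim_inverse_at_top_right, of "-1"]
    by (simp add: divide_inverse)
  have "((\<lambda>\<epsilon>. U (- (- 1 / \<epsilon>)) (\<Psi> \<epsilon> (- 1 / \<epsilon>))) \<longlongrightarrow> \<psi>\<^sub>m) (at_right 0)"
  proof -
    \<comment> \<open>The data differ from those of the free asymptotics by the error of \<open>A\<^sub>m\<close> and by the remainder \<open>r\<close>.\<close>
    let ?d = "\<lambda>s. norm (\<psi>\<^sub>m - U (- s) ((\<bar>s\<bar> powr (- \<alpha>)) *\<^sub>R A\<^sub>m \<psi>\<^sub>m s))"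
    from filterlim_compose[OF A_minus times]
    have lim: "((\<lambda>\<epsilon>. ?d (- 1 / \<epsilon>) + norm_eps rep \<alpha> \<epsilon> (r \<epsilon>)) \<longlongrightarrow> 0) (at_right 0)"
      using assms(8) by (rule tendsto_add_zero)
    have "\<forall>\<^sub>F \<epsilon> in at_right 0. norm (U (- (- 1 / \<epsilon>)) (\<Psi> \<epsilon> (- 1 / \<epsilon>)) - \<psi>\<^sub>m) \<le>
        ?d (- 1 / \<epsilon>) + norm_eps rep \<alpha> \<epsilon> (r \<epsilon>)"
      using pos
    proof eventually_elim
      case (elim \<epsilon>)
      let ?U = "U (- (- 1 / \<epsilon>))"
      let ?a = "\<epsilon> powr \<alpha> *\<^sub>R A\<^sub>m \<psi>\<^sub>m (- 1 / \<epsilon>)"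
      have a: "\<bar>- 1 / \<epsilon>\<bar> powr (- \<alpha>) = \<epsilon> powr \<alpha>"
        using elim by (simp add: powr_divide powr_minus_divide abs_divide)
      have "norm (?U (D \<epsilon>) - \<psi>\<^sub>m) \<le> norm (\<psi>\<^sub>m - ?U ?a) + norm (?U (D \<epsilon>) - ?U ?a)"
        using norm_triangle_ineq[of "?U (D \<epsilon>) - ?U ?a" "?U ?a - \<psi>\<^sub>m"]
        by (simp add: norm_minus_commute[of \<psi>\<^sub>m])
      also have "norm (?U (D \<epsilon>) - ?U ?a) = norm_eps rep \<alpha> \<epsilon> (r \<epsilon>)"
        by (simp only: norm_U_diff) (simp add: D_def norm_eps_def)
      finally show ?case
        unfolding a \<Psi>(2) .
    qed
    then show ?thesis
      by (rule Lim_null_comparison[OF _ lim, THEN LIM_zero_cancel])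
  qed
  then have converge: "\<forall>\<^sub>F \<epsilon> in at_right 0. \<forall>t. norm (\<Psi> \<epsilon> t - \<psi> t) \<le> \<eta>" if "\<eta> > 0" for \<eta>
  proof (intro uniform_convergence_to_incoming[OF \<psi>])
    show "filterlim (\<lambda>\<epsilon>. - 1 / \<epsilon>) at_bot (at_right (0::real))"
      by (rule times)
  qed (use \<Psi>(1) that in auto)
  have eq_profile: "v t = \<epsilon> powr (- \<alpha>) *\<^sub>R dilate rep (1 / \<epsilon>) (\<Psi> \<epsilon> ((t - 1) / \<epsilon>))"
    if "\<epsilon> > 0" "semiclassical_solution rep P F p \<alpha> (A\<^sub>m \<psi>\<^sub>m) (r \<epsilon>) \<epsilon> v" "t \<ge> 0" for \<epsilon> v t
    using that assms(4) \<Psi>[of \<epsilon>] by (intro semiclassical_solution_eq) (auto simp: D_def)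
  have wellposed: "\<exists>u. semiclassical_solution rep P F p \<alpha> (A\<^sub>m \<psi>\<^sub>m) (r \<epsilon>) \<epsilon> u \<and>
      (\<forall>v. semiclassical_solution rep P F p \<alpha> (A\<^sub>m \<psi>\<^sub>m) (r \<epsilon>) \<epsilon> v \<longrightarrow> (\<forall>t\<ge>0. v t = u t))" if "\<epsilon> > 0" for \<epsilon>
  proof -
    have "semiclassical_solution rep P F p \<alpha> (A\<^sub>m \<psi>\<^sub>m) (r \<epsilon>) \<epsilon>
        (\<lambda>t. \<epsilon> powr (- \<alpha>) *\<^sub>R dilate rep (1 / \<epsilon>) (\<Psi> \<epsilon> ((t - 1) / \<epsilon>)))"
      using that assms(4) solution_subset[OF \<Psi>(1) subset_UNIV] \<Psi>(2)[of \<epsilon>, unfolded D_def]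
      by (rule semiclassical_solution_of_profile)
    then show ?thesis
      using eq_profile[OF that] by blast
  qed
  show ?thesis
  \<comment> \<open>The rescaled problem is globally well-posed for all \<open>\<epsilon> > 0\<close>, so the whole range of \<open>\<epsilon>\<close> can be taken.\<close>
  proof (intro exI[of _ 1] conjI ballI allI impI)
    fix u
    assume u: "\<forall>\<epsilon>\<in>{0<..<1}. semiclassical_solution rep P F p \<alpha> (A\<^sub>m \<psi>\<^sub>m) (r \<epsilon>) \<epsilon> (u \<epsilon>)"
    have profile: "\<forall>\<^sub>F \<epsilon> in at_right 0. \<forall>t\<ge>0. u \<epsilon> t = \<epsilon> powr (- \<alpha>) *\<^sub>R dilate rep (1 / \<epsilon>) (\<Psi> \<epsilon> ((t - 1) / \<epsilon>))"
      using eventually_at_right_real[of 0 1] by (rule eventually_mono) (use u eq_profile in auto)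
    show "((\<lambda>\<epsilon>. SUP t\<in>{0..\<tau>}. ereal (norm_eps rep \<alpha> \<epsilon>
          (u \<epsilon> t - (1 / (1 - t) powr \<alpha>) *\<^sub>R dilate rep (1 / \<epsilon>) (A\<^sub>m \<psi>\<^sub>m ((t - 1) / \<epsilon>)))))
        \<longlongrightarrow> 0) (at_right 0)" if "0 < \<tau> \<and> \<tau> < 1" for \<tau>
    proof -
      have "((\<lambda>\<epsilon>. SUP t\<in>{0..\<tau>}. ereal (norm_eps rep \<alpha> \<epsilon>
          (u \<epsilon> t - (1 / \<bar>t - 1\<bar> powr \<alpha>) *\<^sub>R dilate rep (1 / \<epsilon>) (A\<^sub>m \<psi>\<^sub>m ((t - 1) / \<epsilon>)))))
        \<longlongrightarrow> 0) (at_right 0)"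
      proof (rule sup_norm_eps_tendsto_0[OF _ converge])
        show "\<forall>\<^sub>F \<epsilon> in at_right 0. \<forall>t\<in>{0..\<tau>}. u \<epsilon> t = \<epsilon> powr (- \<alpha>) *\<^sub>R dilate rep (1 / \<epsilon>) (\<Psi> \<epsilon> ((t - 1) / \<epsilon>))"
          using profile by (rule eventually_mono) auto
        show "((\<lambda>s. norm (\<psi> s - \<bar>s\<bar> powr (- \<alpha>) *\<^sub>R A\<^sub>m \<psi>\<^sub>m s)) \<longlongrightarrow> 0) at_bot"
          using \<psi>[unfolded incoming_def, THEN conjunct2] A_minus by (rule asymptotics_transfer)
        show "\<forall>\<^sub>F \<epsilon> in at_right 0. \<forall>t\<in>{0..\<tau>}. Q ((t - 1) / \<epsilon>)" if "eventually Q at_bot" for Q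
          using that \<open>0 < \<tau> \<and> \<tau> < 1\<close> by (intro eventually_rescaled_times_at_bot) auto
      qed (use that in auto)
      moreover have "\<bar>t - 1\<bar> = 1 - t" if "t \<in> {0..\<tau>}" for t
        using that \<open>0 < \<tau> \<and> \<tau> < 1\<close> by auto
      ultimately show ?thesis
        by simp
    qed
    show "((\<lambda>\<epsilon>. SUP t\<in>{\<tau>..}. ereal (norm_eps rep \<alpha> \<epsilon>
          (u \<epsilon> t - (1 / (t - 1) powr \<alpha>) *\<^sub>R dilate rep (1 / \<epsilon>)
            (A\<^sub>p (scattering_operator rep P F U \<psi>\<^sub>m) ((t - 1) / \<epsilon>)))))
        \<longlongrightarrow> 0) (at_right 0)" if "1 < \<tau>" for \<tau>
    proof -
      have "((\<lambda>\<epsilon>. SUP t\<in>{\<tau>..}. ereal (norm_eps rep \<alpha> \<epsilon>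
          (u \<epsilon> t - (1 / \<bar>t - 1\<bar> powr \<alpha>) *\<^sub>R dilate rep (1 / \<epsilon>)
            (A\<^sub>p (scattering_operator rep P F U \<psi>\<^sub>m) ((t - 1) / \<epsilon>)))))
        \<longlongrightarrow> 0) (at_right 0)"
      proof (rule sup_norm_eps_tendsto_0[OF _ converge])
        show "\<forall>\<^sub>F \<epsilon> in at_right 0. \<forall>t\<in>{\<tau>..}. u \<epsilon> t = \<epsilon> powr (- \<alpha>) *\<^sub>R dilate rep (1 / \<epsilon>) (\<Psi> \<epsilon> ((t - 1) / \<epsilon>))"
          using profile by (rule eventually_mono) (use that in auto)
        show "((\<lambda>s. norm (\<psi> s - \<bar>s\<bar> powr (- \<alpha>) *\<^sub>R A\<^sub>p (scattering_operator rep P F U \<psi>\<^sub>m) s)) \<longlongrightarrow> 0) at_top"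
          using tendsto_scattering_operator[OF \<psi>] A_plus by (rule asymptotics_transfer)
        show "\<forall>\<^sub>F \<epsilon> in at_right 0. \<forall>t\<in>{\<tau>..}. Q ((t - 1) / \<epsilon>)" if "eventually Q at_top" for Q
          using that \<open>1 < \<tau>\<close> by (rule eventually_rescaled_times_at_top)
      qed (use that in auto)
      moreover have "\<bar>t - 1\<bar> = t - 1" if "t \<in> {\<tau>..}" for t
        using that \<open>1 < \<tau>\<close> by auto
      ultimately show ?thesis
        by simp
    qed
    have "\<forall>\<^sub>F \<epsilon> in at_right 0. norm_eps rep \<alpha> \<epsilon>
        (u \<epsilon> 1 - (1 / \<epsilon> powr \<alpha>) *\<^sub>R dilate rep (1 / \<epsilon>) (wave_operator rep P F U at_bot \<psi>\<^sub>m)) = norm (\<Psi> \<epsilon> 0 - \<psi> 0)"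
      using profile pos
    proof eventually_elim
      case (elim \<epsilon>)
      then have "u \<epsilon> 1 = \<epsilon> powr (- \<alpha>) *\<^sub>R dilate rep (1 / \<epsilon>) (\<Psi> \<epsilon> 0)"
        by simp
      from norm_eps_profile_diff[OF elim(2) this] elim(2) show ?case
        by (simp add: wave_operator_eq[OF \<psi>])
    qed
    moreover have "((\<lambda>\<epsilon>. norm (\<Psi> \<epsilon> 0 - \<psi> 0)) \<longlongrightarrow> 0) (at_right 0)"
    proof (rule tendstoI)
      fix e :: real
      assume "e > 0"
      with converge[of "e / 2"] show "\<forall>\<^sub>F \<epsilon> in at_right 0. dist (norm (\<Psi> \<epsilon> 0 - \<psi> 0)) 0 < e"
        by (auto elim!: eventually_mono intro: le_less_trans dest: spec[of _ 0])
    qed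
    ultimately show "((\<lambda>\<epsilon>. norm_eps rep \<alpha> \<epsilon>
        (u \<epsilon> 1 - (1 / \<epsilon> powr \<alpha>) *\<^sub>R dilate rep (1 / \<epsilon>) (wave_operator rep P F U at_bot \<psi>\<^sub>m)))
      \<longlongrightarrow> 0) (at_right 0)"
      by (simp add: tendsto_cong)
  qed (use wellposed in auto)
qed

end
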